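(* Let $X\subset\mathbb P^2$ be a zeroscheme with saturated ideal $I_X\subset R=k[x_1,x_2,x_3]$ and minimal free resolution \[ 0\to\bigoplus_{i=1}^{r-1}R(-a_i)\to\bigoplus_{i=1}^{r}R(-d_i)\to I_X\to 0 . \] Let $F\in R_d$ be any homogeneous polynomial of degree $d$ which does not vanish at any point in the support of $X$. Let $a=\max\{a_i\}$. If $d\ge a-1$, then $R/(I_X+(F))$ has the Weak Lefschetz property.
   Context: $k$ is an infinite field and $R$ is standard graded, with $R_d$ its space of forms of degree $d$. A zeroscheme is a zero-dimensional closed subscheme. A standard graded Artinian $k$-algebra $A=\bigoplus A_i$ has the Weak Lefschetz property if for a general linear form $L$ the multiplication map $\times L:A_i\to A_{i+1}$ has maximal rank (is injective or surjective) for every $i$. *)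

theory Defs
  imports
    "HOL-Library.Poly_Mapping"
    "HOL-Library.Numeral_Type"
    "HOL-Library.Extended_Real"
begin

text \<open>
  The polynomial ring over a field \<open>'k\<close> in variables indexed by the finite type \<open>'n\<close>, as finitely
  supported maps from exponent vectors to coefficients, with convolution as product.
\<close>

type_synonym ('n, 'k) mpoly = "('n \<Rightarrow>\<^sub>0 nat) \<Rightarrow>\<^sub>0 'k"

definition monom_degree :: "('n::finite \<Rightarrow>\<^sub>0 nat) \<Rightarrow> nat" where
  "monom_degree m = (\<Sum>i\<in>UNIV. Poly_Mapping.lookup m i)"

text \<open>Degrees are integers, so that twists are written without truncation; \<open>forms e = {0}\<close> if \<open>e < 0\<close>.\<close>

definition forms :: "int \<Rightarrow> ('n::finite, 'k::field) mpoly set" where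
  "forms e = {p. \<forall>m\<in>Poly_Mapping.keys p. int (monom_degree m) = e}"

definition Var :: "'n::finite \<Rightarrow> ('n, 'k::field) mpoly" where
  "Var i = Poly_Mapping.single (Poly_Mapping.single i 1) 1"

definition Const :: "'k::field \<Rightarrow> ('n::finite, 'k) mpoly" where
  "Const c = Poly_Mapping.single 0 c"

definition eval :: "('n::finite, 'k::field) mpoly \<Rightarrow> ('n \<Rightarrow> 'k) \<Rightarrow> 'k" where
  "eval p c = (\<Sum>m\<in>Poly_Mapping.keys p.
     Poly_Mapping.lookup p m * (\<Prod>i\<in>UNIV. c i ^ Poly_Mapping.lookup m i))"


section \<open>Ideals\<close>

text \<open>A commutative ring is a module over itself; its submodules are its ideals.\<close>

interpretation self_module: module "(*) :: 'a::comm_ring_1 \<Rightarrow> 'a \<Rightarrow> 'a"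
  by unfold_locales (simp_all add: algebra_simps)

abbreviation is_ideal :: "'a::comm_ring_1 set \<Rightarrow> bool" where
  "is_ideal \<equiv> module.subspace (*)"

abbreviation ideal_gen :: "'a::comm_ring_1 set \<Rightarrow> 'a set" where
  "ideal_gen \<equiv> module.span (*)"

definition is_prime_ideal :: "'a::comm_ring_1 set \<Rightarrow> bool" where
  "is_prime_ideal P \<longleftrightarrow>
     is_ideal P \<and> P \<noteq> UNIV \<and> (\<forall>f g. f * g \<in> P \<longrightarrow> f \<in> P \<or> g \<in> P)"

definition homogeneous_ideal :: "('n::finite, 'k::field) mpoly set \<Rightarrow> bool" where
  "homogeneous_ideal I \<longleftrightarrow> (\<exists>S \<subseteq> (\<Union>e. forms e). I = ideal_gen S)"

definition irrelevant_ideal :: "('n::finite, 'k::field) mpoly set" where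
  "irrelevant_ideal = ideal_gen (range Var)"

definition saturated :: "('n::finite, 'k::field) mpoly set \<Rightarrow> bool" where
  "saturated I \<longleftrightarrow> (\<forall>f. (\<exists>n::nat. \<forall>g\<in>forms (int n). g * f \<in> I) \<longrightarrow> f \<in> I)"


section \<open>Zeroschemes\<close>

text \<open>
  A closed subscheme \<open>X\<close> of the projective space is given by its saturated homogeneous ideal \<open>I\<close>.
  Its points are all scheme-theoretic points of \<open>Proj (R/I)\<close>, so closed points need not be
  rational over \<open>'k\<close>.
\<close>

definition proj_points :: "('n::finite, 'k::field) mpoly set \<Rightarrow> ('n, 'k) mpoly set set" where
  "proj_points I =
     {P. is_prime_ideal P \<and> homogeneous_ideal P \<and> I \<subseteq> P \<and> \<not> irrelevant_ideal \<subseteq> P}"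

text \<open>
  The dimension is the supremum of the lengths of chains of irreducible closed subsets, that is,
  of chains of points under specialization; the empty scheme has dimension \<open>-\<infinity>\<close>.
\<close>

definition proj_dim :: "('n::finite, 'k::field) mpoly set \<Rightarrow> ereal" where
  "proj_dim I = Sup {ereal (real n) | n. \<exists>P :: nat \<Rightarrow> ('n, 'k) mpoly set.
     (\<forall>i\<le>n. P i \<in> proj_points I) \<and> (\<forall>i<n. P i \<subset> P (Suc i))}"

definition zeroscheme_ideal :: "('n::finite, 'k::field) mpoly set \<Rightarrow> bool" where
  "zeroscheme_ideal I \<longleftrightarrow> homogeneous_ideal I \<and> saturated I \<and> proj_dim I = 0"


section \<open>Minimal free resolutions of length one\<close>

text \<open>
  \<open>I\<close> has a minimal graded free resolution
  \<open>0 \<rightarrow> R(-a 1) \<oplus> \<dots> \<oplus> R(-a s) \<rightarrow> R(-d 1) \<oplus> \<dots> \<oplus> R(-d r) \<rightarrow> I \<rightarrow> 0\<close>.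
  The right-hand map sends the \<open>i\<close>-th basis element to \<open>g i\<close>, the left-hand map sends the \<open>j\<close>-th
  basis element to the \<open>j\<close>-th row of \<open>M\<close>. Both maps are homogeneous of degree zero, and
  minimality means that the entries of \<open>M\<close> lie in the irrelevant ideal. The last three conjuncts
  are exactness at \<open>I\<close>, in the middle, and on the left.
\<close>

definition minimal_free_resolution ::
  "('n::finite, 'k::field) mpoly set \<Rightarrow> nat \<Rightarrow> (nat \<Rightarrow> int) \<Rightarrow> nat \<Rightarrow> (nat \<Rightarrow> int) \<Rightarrow> bool" where
  "minimal_free_resolution I r d s a \<longleftrightarrow>
     (\<exists>(g :: nat \<Rightarrow> ('n, 'k) mpoly) (M :: nat \<Rightarrow> nat \<Rightarrow> ('n, 'k) mpoly).
        (\<forall>i\<in>{1..r}. g i \<in> forms (d i)) \<and>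
        (\<forall>j\<in>{1..s}. \<forall>i\<in>{1..r}. M j i \<in> forms (a j - d i)) \<and>
        (\<forall>j\<in>{1..s}. \<forall>i\<in>{1..r}. M j i \<in> irrelevant_ideal) \<and>
        I = range (\<lambda>u. \<Sum>i=1..r. u i * g i) \<and>
        (\<forall>u. (\<Sum>i=1..r. u i * g i) = 0 \<longleftrightarrow>
             (\<exists>v. \<forall>i\<in>{1..r}. u i = (\<Sum>j=1..s. v j * M j i))) \<and>
        (\<forall>v. (\<forall>i\<in>{1..r}. (\<Sum>j=1..s. v j * M j i) = 0) \<longrightarrow> (\<forall>j\<in>{1..s}. v j = 0)))"


section \<open>The weak Lefschetz property\<close>

text \<open>The elements of the quotient ring modulo \<open>J\<close> are the classes of the following relation.\<close>

definition ideal_cong :: "'a::comm_ring_1 set \<Rightarrow> ('a \<times> 'a) set" where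
  "ideal_cong J = {(f, g). f - g \<in> J}"

definition quotient_piece :: "('n::finite, 'k::field) mpoly set \<Rightarrow> int \<Rightarrow> ('n, 'k) mpoly set set" where
  "quotient_piece J i = forms i // ideal_cong J"

definition quotient_mult :: "'a::comm_ring_1 set \<Rightarrow> 'a \<Rightarrow> 'a set \<Rightarrow> 'a set" where
  "quotient_mult J L C = ideal_cong J `` ((*) L ` C)"

lemma equiv_ideal_cong:
  assumes "is_ideal J"
  shows "equiv UNIV (ideal_cong J)"
proof (rule equivI)
  show "refl (ideal_cong J)"
    using self_module.subspace_0[OF assms] by (auto simp: refl_on_def ideal_cong_def)
  show "sym (ideal_cong J)"
    using self_module.subspace_neg[OF assms] by (fastforce simp: sym_def ideal_cong_def)
  show "trans (ideal_cong J)"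
  proof (rule transI)
    fix f g h assume "(f, g) \<in> ideal_cong J" "(g, h) \<in> ideal_cong J"
    then have "(f - g) + (g - h) \<in> J"
      using self_module.subspace_add[OF assms] unfolding ideal_cong_def by blast
    then show "(f, h) \<in> ideal_cong J" by (simp add: ideal_cong_def)
  qed
qed simp

lemma quotient_mult_class:
  assumes "is_ideal J"
  shows "quotient_mult J L (ideal_cong J `` {f}) = ideal_cong J `` {L * f}"
proof -
  have eq: "equiv UNIV (ideal_cong J)" by (rule equiv_ideal_cong[OF assms])
  have "(L * f, L * g) \<in> ideal_cong J" if "(f, g) \<in> ideal_cong J" for g
    using self_module.subspace_scale[OF assms, of "f - g" L] that
    by (simp add: ideal_cong_def right_diff_distrib)
  moreover have "(f, f) \<in> ideal_cong J"
    using eq by (simp add: equiv_def refl_on_def)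
  ultimately show ?thesis
    unfolding quotient_mult_def
    using eq by (blast elim: equivE dest: symD transD)
qed

text \<open>The descending chain condition in the quotient ring, whose ideals are the ideals containing \<open>J\<close>.\<close>

definition artinian_quotient :: "'a::comm_ring_1 set \<Rightarrow> bool" where
  "artinian_quotient J \<longleftrightarrow>
     (\<forall>C :: nat \<Rightarrow> 'a set. (\<forall>n. is_ideal (C n) \<and> J \<subseteq> C n \<and> C (Suc n) \<subseteq> C n) \<longrightarrow>
        (\<exists>N. \<forall>n\<ge>N. C n = C N))"

definition zariski_closed :: "('n::finite \<Rightarrow> 'k::field) set \<Rightarrow> bool" where
  "zariski_closed Z \<longleftrightarrow> (\<exists>S :: ('n, 'k) mpoly set. Z = {c. \<forall>p\<in>S. eval p c = 0})"

definition linear_form :: "('n::finite \<Rightarrow> 'k::field) \<Rightarrow> ('n, 'k) mpoly" where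
  "linear_form c = (\<Sum>i\<in>UNIV. Const (c i) * Var i)"

text \<open>A property of a general linear form holds on a nonempty Zariski open set of coefficient vectors.\<close>

definition for_general_linear_form :: "(('n::finite, 'k::field) mpoly \<Rightarrow> bool) \<Rightarrow> bool" where
  "for_general_linear_form Q \<longleftrightarrow>
     (\<exists>U :: ('n \<Rightarrow> 'k) set. zariski_closed (- U) \<and> U \<noteq> {} \<and> (\<forall>c\<in>U. Q (linear_form c)))"

definition mult_max_rank :: "('n::finite, 'k::field) mpoly set \<Rightarrow> ('n, 'k) mpoly \<Rightarrow> int \<Rightarrow> bool" where
  "mult_max_rank J L i \<longleftrightarrow>
     inj_on (quotient_mult J L) (quotient_piece J i) \<or>
     quotient_mult J L ` quotient_piece J i = quotient_piece J (i + 1)"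

text \<open>
  The quotient by \<open>J\<close> is a standard graded Artinian algebra with the weak Lefschetz property. Being
  standard graded and Artinian is part of the notion.
\<close>

definition weak_lefschetz_quotient :: "('n::finite, 'k::field) mpoly set \<Rightarrow> bool" where
  "weak_lefschetz_quotient J \<longleftrightarrow>
     homogeneous_ideal J \<and> artinian_quotient J \<and>
     for_general_linear_form (\<lambda>L. \<forall>i. mult_max_rank J L i)"

end

theory Submission
  imports Defs "HOL-Computational_Algebra.Polynomial"
begin

text \<open>
  Write \<open>I\<close> for the ideal of \<open>X\<close>, \<open>A = R/(I + (F))\<close>, and \<open>e\<close> for the degree of \<open>F\<close>. Let \<open>L\<close> be a linear form
  that misses all points of \<open>X\<close>. Then \<open>L\<close> is a nonzerodivisor on \<open>R/I\<close>, and multiplication by \<open>L\<close> on \<open>A\<close> behaves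
  differently on the two sides of degree \<open>e\<close>.

  In degrees below \<open>e\<close>, the algebra \<open>A\<close> coincides with \<open>R/I\<close>, so multiplication into these degrees is
  injective. In degrees \<open>t \<ge> e\<close> it is surjective, because its cokernel is a quotient of the degree \<open>t\<close>
  piece of \<open>B = R/(I + (L))\<close>, and that piece is zero: \<open>B\<close> is an Artinian quotient of a polynomial ring in two
  variables, resolved by the reduction of the given resolution modulo \<open>L\<close>, so its socle lives in
  the degrees \<open>a\<^sub>l - 2\<close>, all less than \<open>e\<close>. The bound on the socle is \<open>socle_descent\<close>, proved by chasing
  syzygies by hand, and the vanishing of \<open>B\<close> is \<open>forms_in_hyperplane_section\<close>.

  Three facts of algebraic geometry are needed, all in elementary form. A homogeneous ideal
  without points contains all forms of large degree (\<open>contains_high_forms\<close>); together with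
  \<open>artinian_if_contains_high_forms\<close> this makes \<open>A\<close> Artinian. A form that misses all points is a
  nonzerodivisor modulo a saturated ideal (\<open>saturated_nonzerodivisor\<close>). A general linear form misses all
  points (\<open>general_linear_form_avoids\<close>), because there are finitely many of them (\<open>finite_points\<close>);
  here \<open>F\<close> itself is used to bound the Hilbert function of \<open>R/I\<close>.
\<close>

(* As a rewrite rule, the scaling law of the ring as a module over itself reassociates products to
   the left; together with the ring normalization rules it loops. *)
declare self_module.scale_scale [simp del]

section \<open>Homogeneous components\<close>

definition component :: "int \<Rightarrow> ('n::finite, 'k::field) mpoly \<Rightarrow> ('n, 'k) mpoly" where
  "component e p = Poly_Mapping.mapp (\<lambda>m c. if int (monom_degree m) = e then c else 0) p"

lemma lookup_component:
  "Poly_Mapping.lookup (component e p) m =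
     (if int (monom_degree m) = e then Poly_Mapping.lookup p m else 0)"
  by (auto simp: component_def lookup_mapp when_def in_keys_iff)

lemma component_zero [simp]: "component e 0 = 0"
  by (rule poly_mapping_eqI) (simp add: lookup_component)

lemma component_add: "component e (p + q) = component e p + component e q"
  by (rule poly_mapping_eqI) (simp add: lookup_component lookup_add)

lemma component_minus: "component e (p - q) = component e p - component e q"
  by (rule poly_mapping_eqI) (simp add: lookup_component lookup_minus)

lemma component_sum: "component e (sum f A) = (\<Sum>x\<in>A. component e (f x))"
  by (induction A rule: infinite_finite_induct) (simp_all add: component_add)

lemma forms_iff_lookup:
  "p \<in> forms e \<longleftrightarrow> (\<forall>m. Poly_Mapping.lookup p m \<noteq> 0 \<longrightarrow> int (monom_degree m) = e)"
  by (auto simp: forms_def in_keys_iff)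

lemma forms_iff_component: "p \<in> forms e \<longleftrightarrow> component e p = p"
  by (auto simp: forms_iff_lookup poly_mapping_eq_iff fun_eq_iff lookup_component)

lemma component_in_forms [simp]: "component e p \<in> forms e"
  by (auto simp: forms_iff_lookup lookup_component)

lemma zero_in_forms [simp]: "0 \<in> forms e"
  by (simp add: forms_def)

lemma forms_add: "p \<in> forms e \<Longrightarrow> q \<in> forms e \<Longrightarrow> p + q \<in> forms e"
  by (simp add: forms_iff_component component_add)

lemma forms_minus: "p \<in> forms e \<Longrightarrow> q \<in> forms e \<Longrightarrow> p - q \<in> forms e"
  by (simp add: forms_iff_component component_minus)

lemma forms_sum: "(\<And>x. x \<in> A \<Longrightarrow> f x \<in> forms e) \<Longrightarrow> sum f A \<in> forms e"
  by (simp add: forms_iff_component component_sum)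

lemma forms_negative: "e < 0 \<Longrightarrow> p \<in> forms e \<Longrightarrow> p = 0"
  by (auto simp: forms_iff_lookup poly_mapping_eq_iff fun_eq_iff)

lemma monom_degree_zero [simp]: "monom_degree 0 = 0"
  by (simp add: monom_degree_def)

lemma monom_degree_add: "monom_degree (m + m') = monom_degree m + monom_degree m'"
  by (simp add: monom_degree_def lookup_add sum.distrib)

lemma monom_degree_single [simp]: "monom_degree (Poly_Mapping.single i n) = n"
  by (simp add: monom_degree_def lookup_single when_def)

lemma forms_mult: "p \<in> forms d \<Longrightarrow> q \<in> forms e \<Longrightarrow> p * q \<in> forms (d + e)"
  using keys_mult[of p q] by (fastforce simp: forms_def monom_degree_add)

lemma one_in_forms: "1 \<in> forms 0"
  by (simp add: forms_def)

lemma Const_in_forms: "Const c \<in> forms 0"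
  by (simp add: forms_def Const_def)

lemma Var_in_forms: "Var i \<in> forms 1"
  by (simp add: forms_def Var_def)

lemma forms_power: "p \<in> forms e \<Longrightarrow> p ^ n \<in> forms (int n * e)"
  by (induction n) (auto simp: one_in_forms forms_mult algebra_simps)

lemma forms_prod:
  assumes "\<And>x. x \<in> A \<Longrightarrow> f x \<in> forms (d x)"
  shows "prod f A \<in> forms (sum d A)"
  using assms
  by (induction A rule: infinite_finite_induct) (auto simp: one_in_forms forms_mult)

lemma linear_form_in_forms: "linear_form c \<in> forms 1"
  unfolding linear_form_def
  using forms_mult[OF Const_in_forms Var_in_forms] by (auto intro: forms_sum)

text \<open>
  Multiplication by a form shifts degrees, so taking a component of a relation with homogeneous
  coefficients gives a relation whose unknowns are homogeneous of the expected degrees. All degree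
  bookkeeping below rests on this.
\<close>

lemma component_mult:
  assumes "g \<in> forms e"
  shows "component n (p * g) = component (n - e) p * g"
proof -
  define q where "q = p - component (n - e) p"
  have "int (monom_degree m) \<noteq> n - e" if "m \<in> Poly_Mapping.keys q" for m
    using that by (auto simp: q_def in_keys_iff lookup_minus lookup_component)
  then have "int (monom_degree m) \<noteq> n" if "m \<in> Poly_Mapping.keys (q * g)" for m
    using that keys_mult[of q g] assms by (fastforce simp: forms_def monom_degree_add)
  then have "component n (q * g) = 0"
    by (auto simp: poly_mapping_eq_iff fun_eq_iff lookup_component in_keys_iff)
  moreover have "component n (component (n - e) p * g) = component (n - e) p * g"
    using forms_mult[OF component_in_forms[of "n - e" p] assms] by (simp add: forms_iff_component)
  moreover have "p * g = q * g + component (n - e) p * g"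
    by (simp add: q_def algebra_simps)
  ultimately show ?thesis by (simp add: component_add)
qed

lemma sum_components:
  assumes "\<And>m. m \<in> Poly_Mapping.keys p \<Longrightarrow> monom_degree m \<le> N"
  shows "(\<Sum>n\<le>N. component (int n) p) = p"
proof (rule poly_mapping_eqI)
  fix m
  show "Poly_Mapping.lookup (\<Sum>n\<le>N. component (int n) p) m = Poly_Mapping.lookup p m"
    using assms[of m] by (cases "m \<in> Poly_Mapping.keys p")
      (auto simp: lookup_sum lookup_component in_keys_iff)
qed

lemma ex_sum_components: "\<exists>N. (\<Sum>n\<le>N. component (int n) p) = p"
proof -
  have "monom_degree m \<le> Max (monom_degree ` Poly_Mapping.keys p)"
    if "m \<in> Poly_Mapping.keys p" for m
    using that by simp
  then show ?thesis using sum_components by blast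
qed

lemma sum_monomials: "(\<Sum>m\<in>Poly_Mapping.keys p. Poly_Mapping.single m (Poly_Mapping.lookup p m)) = p"
  by (rule poly_mapping_eqI) (auto simp: lookup_sum lookup_single when_def in_keys_iff)

lemma Const_mult_single: "Const c * Poly_Mapping.single m 1 = Poly_Mapping.single m c"
  by (simp add: Const_def mult_single)

lemma Const_add: "Const (a + b) = Const a + Const b"
  by (simp add: Const_def single_add)

lemma Const_mult: "Const (a * b) = Const a * Const b"
  by (simp add: Const_def mult_single)

lemma Const_zero [simp]: "Const 0 = 0"
  by (simp add: Const_def)

lemma Const_one [simp]: "Const 1 = 1"
  by (simp add: Const_def)

lemma Const_inverse: "c \<noteq> 0 \<Longrightarrow> Const (inverse c) * Const c = 1"
  by (simp add: Const_mult[symmetric])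

section \<open>Homogeneous ideals\<close>

lemmas ideal_add = self_module.subspace_add
lemmas ideal_minus = self_module.subspace_diff
lemmas ideal_mult = self_module.subspace_scale
lemmas ideal_sum = self_module.subspace_sum
lemmas ideal_zero = self_module.subspace_0

lemma ideal_mult_left: "is_ideal I \<Longrightarrow> p \<in> I \<Longrightarrow> p * q \<in> I"
  by (subst mult.commute) (rule ideal_mult)

text \<open>
  Being generated by forms is hard to transport, while being closed under components passes directly
  to unions of chains and to sums.
\<close>

lemma homogeneous_ideal_iff:
  "homogeneous_ideal I \<longleftrightarrow> is_ideal I \<and> (\<forall>p\<in>I. \<forall>e. component e p \<in> I)"
proof safe
  assume "homogeneous_ideal I"
  then obtain S where S: "S \<subseteq> (\<Union>e. forms e)" and I: "I = ideal_gen S"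
    by (auto simp: homogeneous_ideal_def)
  show id: "is_ideal I" by (simp add: I)
  fix p e assume "p \<in> I"
  then have "p \<in> ideal_gen S" by (simp add: I)
  then show "component e p \<in> I"
  proof (induction rule: self_module.span_induct_alt)
    case base
    show ?case using ideal_zero[OF id] by simp
  next
    case (step c x y)
    obtain d where "x \<in> forms d" using S step(1) by blast
    then have "component e (c * x + y) = component (e - d) c * x + component e y"
      by (simp add: component_add component_mult)
    moreover have "x \<in> I" using step(1) by (simp add: I self_module.span_base)
    ultimately show ?case using step(2) id by (simp add: ideal_add ideal_mult)
  qed
next
  assume id: "is_ideal I" and c: "\<forall>p\<in>I. \<forall>e. component e p \<in> I"
  define S where "S = I \<inter> (\<Union>e. forms e)"
  have "p \<in> ideal_gen S" if "p \<in> I" for p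
  proof -
    obtain N where N: "(\<Sum>n\<le>N. component (int n) p) = p" using ex_sum_components by blast
    have "component (int n) p \<in> S" for n using c that component_in_forms unfolding S_def by blast
    then have "(\<Sum>n\<le>N. component (int n) p) \<in> ideal_gen S"
      by (intro self_module.span_sum self_module.span_base)
    then show ?thesis using N by simp
  qed
  moreover have "ideal_gen S \<subseteq> I"
    using self_module.span_minimal[OF _ id, of S] by (auto simp: S_def)
  ultimately show "homogeneous_ideal I"
    unfolding homogeneous_ideal_def by (intro exI[of _ S]) (auto simp: S_def)
qed

lemma homogeneous_is_ideal: "homogeneous_ideal I \<Longrightarrow> is_ideal I"
  by (simp add: homogeneous_ideal_iff)

lemma homogeneous_component: "homogeneous_ideal I \<Longrightarrow> p \<in> I \<Longrightarrow> component e p \<in> I"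
  by (simp add: homogeneous_ideal_iff)

lemma mem_adjoin_iff:
  assumes "is_ideal I"
  shows "p \<in> ideal_gen (I \<union> {F}) \<longleftrightarrow> (\<exists>h. p - h * F \<in> I)"
proof -
  have eq: "ideal_gen I = I" using assms self_module.span_eq_iff by blast
  show ?thesis unfolding Un_insert_right Un_empty_right self_module.span_insert eq by simp
qed

lemma mem_adjoinI: "is_ideal I \<Longrightarrow> p - h * F \<in> I \<Longrightarrow> p \<in> ideal_gen (I \<union> {F})"
  using mem_adjoin_iff by blast

lemma subset_adjoin: "I \<subseteq> ideal_gen (I \<union> {F})"
  by (auto intro: self_module.span_base)

lemma adjoined_mem: "F \<in> ideal_gen (I \<union> {F})"
  by (auto intro: self_module.span_base)

lemma homogeneous_adjoin:
  assumes I: "homogeneous_ideal I" and F: "F \<in> forms e"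
  shows "homogeneous_ideal (ideal_gen (I \<union> {F}))"
  unfolding homogeneous_ideal_iff
proof (intro conjI ballI allI)
  show "is_ideal (ideal_gen (I \<union> {F}))" by simp
  note id = homogeneous_is_ideal[OF I]
  fix p n assume "p \<in> ideal_gen (I \<union> {F})"
  then obtain h where "p - h * F \<in> I" using mem_adjoin_iff[OF id] by blast
  then have "component n p - component (n - e) h * F \<in> I"
    using homogeneous_component[OF I] by (metis component_minus component_mult[OF F])
  then show "component n p \<in> ideal_gen (I \<union> {F})" by (rule mem_adjoinI[OF id])
qed

text \<open>
  In a relation for a form of degree \<open>t\<close>, the cofactor of \<open>F\<close> may be taken homogeneous: replace it by its
  component of degree \<open>t - e\<close>.
\<close>

lemma form_mem_adjoin:
  assumes I: "homogeneous_ideal I" and F: "F \<in> forms e"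
    and p: "p \<in> forms t" "p \<in> ideal_gen (I \<union> {F})"
  obtains h where "h \<in> forms (t - e)" "p - h * F \<in> I"
proof -
  obtain h where "p - h * F \<in> I"
    using p mem_adjoin_iff[OF homogeneous_is_ideal[OF I]] by blast
  from homogeneous_component[OF I this, of t]
  have "p - component (t - e) h * F \<in> I"
    using p(1) by (simp add: component_minus component_mult[OF F] forms_iff_component)
  then show ?thesis using that component_in_forms by blast
qed

section \<open>Homogeneous primes and the projective Nullstellensatz\<close>

lemma prime_ideal_power:
  assumes "is_prime_ideal P" "f ^ n \<in> P"
  shows "f \<in> P"
  using assms(2)
proof (induction n)
  case 0
  have "f * 1 \<in> P"
    using 0 assms(1) ideal_mult[of P 1 f] by (simp add: is_prime_ideal_def)
  then show ?case by simp
next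
  case (Suc n)
  then show ?case using assms(1) by (auto simp: is_prime_ideal_def)
qed

text \<open>
  If neither factor lies in \<open>P\<close>, discard from each factor the components of high degree that do lie in
  \<open>P\<close>. The product of the two remaining leading components is the top component of an element of
  \<open>P\<close>, so it lies in \<open>P\<close>, although neither leading component does.
\<close>

lemma prime_if_prime_on_forms:
  fixes P :: "('n::finite, 'k::field) mpoly set"
  assumes hom: "homogeneous_ideal P" and neq: "P \<noteq> UNIV"
    and forms: "\<And>d e f g. f \<in> forms d \<Longrightarrow> g \<in> forms e \<Longrightarrow> f * g \<in> P \<Longrightarrow> f \<in> P \<or> g \<in> P"
  shows "is_prime_ideal P"
  unfolding is_prime_ideal_def
proof (intro conjI allI impI)
  show id: "is_ideal P" using hom by (rule homogeneous_is_ideal)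
  have split: "\<exists>n h. f - (component (int n) f + h) \<in> P \<and> component (int n) f \<notin> P \<and>
      (\<forall>m\<in>Poly_Mapping.keys h. monom_degree m < n)" if "f \<notin> P" for f
  proof -
    obtain N where N: "(\<Sum>n\<le>N. component (int n) f) = f" using ex_sum_components by blast
    define B where "B = {n. n \<le> N \<and> component (int n) f \<notin> P}"
    have fin: "finite B" unfolding B_def by simp
    have "B \<noteq> {}"
    proof
      assume "B = {}"
      then have "(\<Sum>n\<le>N. component (int n) f) \<in> P"
        by (intro ideal_sum[OF id]) (auto simp: B_def)
      then show False using N that by simp
    qed
    define n where "n = Max B"
    have nB: "n \<in> B" unfolding n_def using fin \<open>B \<noteq> {}\<close> by (rule Max_in)
    define h where "h = (\<Sum>i<n. component (int i) f)"
    \<comment> \<open>The degree \<open>n\<close> is the largest one whose component is outside \<open>P\<close>.\<close>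
    have "f = (\<Sum>i<n. component (int i) f) + (\<Sum>i\<in>{n..N}. component (int i) f)"
    proof -
      have "{..N} = {..<n} \<union> {n..N}" using nB by (auto simp: B_def)
      then show ?thesis using sum.union_disjoint[of "{..<n}" "{n..N}" "\<lambda>i. component (int i) f"] N
        by (simp add: ivl_disj_int)
    qed
    also have "(\<Sum>i\<in>{n..N}. component (int i) f)
        = component (int n) f + (\<Sum>i\<in>{n<..N}. component (int i) f)"
      using nB by (intro sum.head) (auto simp: B_def)
    finally have "f = h + (component (int n) f + (\<Sum>i\<in>{n<..N}. component (int i) f))"
      unfolding h_def .
    then have rest: "f - (component (int n) f + h) = (\<Sum>i\<in>{n<..N}. component (int i) f)"
      by (simp only: diff_eq_eq ac_simps)
    have "component (int i) f \<in> P" if "i \<in> {n<..N}" for i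
    proof -
      have "i \<notin> B" using that fin n_def by (meson Max_ge greaterThanAtMost_iff leD)
      then show ?thesis using that by (auto simp: B_def)
    qed
    then have "f - (component (int n) f + h) \<in> P" unfolding rest by (rule ideal_sum[OF id])
    moreover have "monom_degree m < n" if "m \<in> Poly_Mapping.keys h" for m
    proof (rule ccontr)
      assume "\<not> monom_degree m < n"
      then have "Poly_Mapping.lookup h m = 0"
        by (auto simp: h_def lookup_sum lookup_component intro!: sum.neutral)
      then show False using that by (simp add: in_keys_iff)
    qed
    ultimately show ?thesis using nB by (auto simp: B_def)
  qed
  fix f g assume fg: "f * g \<in> P"
  show "f \<in> P \<or> g \<in> P"
  proof (rule ccontr)
    assume "\<not> (f \<in> P \<or> g \<in> P)"
    then have nf: "f \<notin> P" and ng: "g \<notin> P" by auto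
    obtain a f' where f: "f - (component (int a) f + f') \<in> P" "component (int a) f \<notin> P"
         "\<forall>m\<in>Poly_Mapping.keys f'. monom_degree m < a"
      using split[OF nf] by (elim exE conjE)
    obtain b g' where g: "g - (component (int b) g + g') \<in> P" "component (int b) g \<notin> P"
         "\<forall>m\<in>Poly_Mapping.keys g'. monom_degree m < b"
      using split[OF ng] by (elim exE conjE)
    let ?f = "component (int a) f" and ?g = "component (int b) g"
    have "f * g - (f - (?f + f')) * g - (?f + f') * (g - (?g + g')) \<in> P"
      by (intro ideal_minus[OF id] fg ideal_mult[OF id] ideal_mult_left[OF id] f g)
    then have 1: "(?f + f') * (?g + g') \<in> P" by (simp add: algebra_simps)
    have 2: "(?f + f') * (?g + g') = ?f * ?g + (f' * ?g + ?f * g' + f' * g')"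
      by (simp add: algebra_simps)
    have z: "component (int a + int b) p = 0"
      if "\<And>m. m \<in> Poly_Mapping.keys p \<Longrightarrow> monom_degree m < a + b" for p :: "('n, 'k) mpoly"
      using that by (fastforce simp: poly_mapping_eq_iff fun_eq_iff lookup_component in_keys_iff)
    have ka: "monom_degree m = a" if "m \<in> Poly_Mapping.keys ?f" for m
      using that component_in_forms[of "int a" f] by (auto simp: forms_def)
    have kb: "monom_degree m = b" if "m \<in> Poly_Mapping.keys ?g" for m
      using that component_in_forms[of "int b" g] by (auto simp: forms_def)
    have "component (int a + int b) (f' * ?g) = 0"
      using keys_mult[of f' ?g] f(3) kb by (intro z) (fastforce simp: monom_degree_add)
    moreover have "component (int a + int b) (?f * g') = 0"
      using keys_mult[of ?f g'] g(3) ka by (intro z) (fastforce simp: monom_degree_add)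
    moreover have "component (int a + int b) (f' * g') = 0"
      using keys_mult[of f' g'] f(3) g(3)
      by (intro z) (fastforce simp: monom_degree_add intro: add_strict_mono)
    moreover have "component (int a + int b) (?f * ?g) = ?f * ?g"
      using forms_mult[OF component_in_forms component_in_forms] by (simp add: forms_iff_component)
    ultimately have "?f * ?g \<in> P"
      using homogeneous_component[OF hom 1, of "int a + int b"] by (simp add: 2 component_add)
    then show False using forms[OF component_in_forms component_in_forms] f(2) g(2) by blast
  qed
qed (rule neq)

text \<open>
  Among the homogeneous ideals above \<open>J\<close> that contain no power of \<open>X\<close>, Zorn's lemma gives a maximal one,
  and maximality makes it prime on forms: enlarging it by either of two forms outside it captures a
  power of \<open>X\<close>, and the product of the two powers would be captured by their product.
\<close>

lemma ex_homogeneous_prime: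
  fixes J :: "('n::finite, 'k::field) mpoly set"
  assumes J: "homogeneous_ideal J" and X: "\<And>n. X ^ n \<notin> J"
  obtains P where "is_prime_ideal P" "homogeneous_ideal P" "J \<subseteq> P" "X \<notin> P"
proof -
  define \<A> where "\<A> = {K. homogeneous_ideal K \<and> J \<subseteq> K \<and> (\<forall>n. X ^ n \<notin> K)}"
  have "J \<in> \<A>" using assms by (simp add: \<A>_def)
  then have "\<A> \<noteq> {}" by blast
  moreover have "\<Union>C \<in> \<A>" if C: "C \<noteq> {}" "subset.chain \<A> C" for C
  proof -
    have CA: "K \<in> \<A>" if "K \<in> C" for K using C(2) that by (auto simp: subset.chain_def)
    have comp: "K \<subseteq> K' \<or> K' \<subseteq> K" if "K \<in> C" "K' \<in> C" for K K'
      using C(2) that by (auto simp: subset_chain_def)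
    have CI: "is_ideal K" if "K \<in> C" for K
      using CA[OF that] homogeneous_is_ideal unfolding \<A>_def by blast
    have "is_ideal (\<Union>C)"
    proof (rule self_module.subspaceI)
      obtain K where "K \<in> C" using C(1) by blast
      then show "0 \<in> \<Union>C" using ideal_zero[OF CI] by blast
    next
      fix p q assume "p \<in> \<Union>C" "q \<in> \<Union>C"
      then obtain K where "K \<in> C" "p \<in> K" "q \<in> K" using comp by blast
      then show "p + q \<in> \<Union>C" using ideal_add[OF CI] by blast
    next
      fix c p assume "p \<in> \<Union>C"
      then obtain K where "K \<in> C" "p \<in> K" by blast
      then show "c * p \<in> \<Union>C" using ideal_mult[OF CI] by blast
    qed
    moreover have "component e p \<in> \<Union>C" if p: "p \<in> \<Union>C" for p e
    proof -
      obtain K where "K \<in> C" "p \<in> K" using p by blast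
      moreover have "homogeneous_ideal K" using CA[OF \<open>K \<in> C\<close>] by (simp add: \<A>_def)
      ultimately show ?thesis using homogeneous_component by blast
    qed
    ultimately have "homogeneous_ideal (\<Union>C)" by (simp add: homogeneous_ideal_iff)
    moreover have "J \<subseteq> \<Union>C" "X ^ n \<notin> \<Union>C" for n
      using C(1) CA by (auto simp: \<A>_def)
    ultimately show ?thesis by (simp add: \<A>_def)
  qed
  ultimately obtain P where P: "P \<in> \<A>" and max: "\<And>K. K \<in> \<A> \<Longrightarrow> P \<subseteq> K \<Longrightarrow> K = P"
    using subset_Zorn_nonempty[of \<A>] by blast
  have hom: "homogeneous_ideal P" and JP: "J \<subseteq> P" and XP: "\<And>n. X ^ n \<notin> P"
    using P by (auto simp: \<A>_def)
  note id = homogeneous_is_ideal[OF hom]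
  have power: "\<exists>n h. X ^ n - h * f \<in> P" if f: "f \<in> forms d" "f \<notin> P" for f d
  proof -
    let ?K = "ideal_gen (P \<union> {f})"
    have "?K \<noteq> P" using adjoined_mem f(2) by blast
    moreover have "P \<subseteq> ?K" by (rule subset_adjoin)
    ultimately have "?K \<notin> \<A>" using max by blast
    then obtain n where "X ^ n \<in> ?K"
      using homogeneous_adjoin[OF hom f(1)] JP \<open>P \<subseteq> ?K\<close> by (auto simp: \<A>_def)
    then show ?thesis using mem_adjoin_iff[OF id] by blast
  qed
  have "is_prime_ideal P"
  proof (rule prime_if_prime_on_forms[OF hom])
    show "P \<noteq> UNIV" using XP by blast
  next
    fix d e f g assume fg: "f \<in> forms d" "g \<in> forms e" "f * g \<in> P"
    show "f \<in> P \<or> g \<in> P"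
    proof (rule ccontr)
      assume "\<not> (f \<in> P \<or> g \<in> P)"
      then have nf: "f \<notin> P" and ng: "g \<notin> P" by auto
      obtain a u where 1: "X ^ a - u * f \<in> P" using power[OF fg(1) nf] by (elim exE)
      obtain b v where 2: "X ^ b - v * g \<in> P" using power[OF fg(2) ng] by (elim exE)
      have "(X ^ a - u * f) * X ^ b \<in> P" by (rule ideal_mult_left[OF id 1])
      moreover have "(u * f) * (X ^ b - v * g) \<in> P" by (rule ideal_mult[OF id 2])
      moreover have "(u * v) * (f * g) \<in> P" by (rule ideal_mult[OF id fg(3)])
      moreover have "X ^ (a + b) =
          (X ^ a - u * f) * X ^ b + (u * f) * (X ^ b - v * g) + (u * v) * (f * g)"
        by (simp add: algebra_simps power_add)
      ultimately have "X ^ (a + b) \<in> P" using ideal_add[OF id] by metis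
      then show False using XP by blast
    qed
  qed
  moreover have "X \<notin> P" using XP[of 1] by simp
  ultimately show ?thesis using that hom JP by blast
qed

lemma Var_in_irrelevant: "Var i \<in> irrelevant_ideal"
  by (simp add: irrelevant_ideal_def self_module.span_base)

lemma irrelevant_subset_iff: "is_ideal P \<Longrightarrow> irrelevant_ideal \<subseteq> P \<longleftrightarrow> (\<forall>i. Var i \<in> P)"
  using self_module.span_minimal[of "range Var" P] Var_in_irrelevant
  by (auto simp: irrelevant_ideal_def)

lemma Var_power: "Var i ^ n = Poly_Mapping.single (Poly_Mapping.single i n) 1"
proof (induction n)
  case (Suc n)
  have "Poly_Mapping.single i (Suc 0) + Poly_Mapping.single i n = Poly_Mapping.single i (Suc n)"
    by (simp add: single_add[symmetric])
  with Suc show ?case by (simp add: Var_def mult_single)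
qed simp

lemma single_add_le:
  fixes m :: "'a \<Rightarrow>\<^sub>0 nat"
  assumes "n \<le> Poly_Mapping.lookup m i"
  shows "m = Poly_Mapping.single i n + (m - Poly_Mapping.single i n)"
  using assms
  by (auto intro!: poly_mapping_eqI simp: lookup_add lookup_minus lookup_single when_def)

lemma mem_ideal_monomials:
  fixes p :: "('n::finite, 'k::field) mpoly"
  assumes "is_ideal K" "\<And>m. m \<in> Poly_Mapping.keys p \<Longrightarrow> Poly_Mapping.single m 1 \<in> K"
  shows "p \<in> K"
proof -
  have "(\<Sum>m\<in>Poly_Mapping.keys p. Const (Poly_Mapping.lookup p m) * Poly_Mapping.single m 1) \<in> K"
    using assms by (intro ideal_sum ideal_mult) auto
  then show ?thesis by (simp add: Const_mult_single sum_monomials)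
qed

text \<open>
  The projective Nullstellensatz. Without points above \<open>J\<close>, every variable has a power in \<open>J\<close>, and a monomial
  of large degree is divisible by one of these powers.
\<close>

lemma contains_high_forms:
  fixes J :: "('n::finite, 'k::field) mpoly set"
  assumes J: "homogeneous_ideal J" and empty: "proj_points J = {}"
  obtains N where "\<And>t. t \<ge> int N \<Longrightarrow> forms t \<subseteq> J"
proof -
  note id = homogeneous_is_ideal[OF J]
  have "\<exists>n. Var i ^ n \<in> J" for i
  proof (rule ccontr)
    assume "\<nexists>n. Var i ^ n \<in> J"
    then obtain P where "is_prime_ideal P" "homogeneous_ideal P" "J \<subseteq> P" "Var i \<notin> P"
      using ex_homogeneous_prime[OF J] by metis
    then have "P \<in> proj_points J"
      using Var_in_irrelevant by (auto simp: proj_points_def)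
    then show False using empty by simp
  qed
  then obtain n where n: "\<And>i. Var i ^ n i \<in> J" by metis
  have "p \<in> J" if t: "t \<ge> int (\<Sum>i\<in>UNIV. n i) + 1" and p: "p \<in> forms t" for t p
  proof (rule mem_ideal_monomials[OF id])
    fix m assume "m \<in> Poly_Mapping.keys p"
    then have "int (monom_degree m) = t" using p by (auto simp: forms_def)
    then have "(\<Sum>i\<in>UNIV. n i) < (\<Sum>i\<in>UNIV. Poly_Mapping.lookup m i)"
      using t unfolding monom_degree_def by linarith
    then obtain i where i: "n i \<le> Poly_Mapping.lookup m i"
      using sum_mono[of UNIV "Poly_Mapping.lookup m" n] by (meson leD nat_le_linear)
    have "Poly_Mapping.single m 1 =
        Var i ^ n i * Poly_Mapping.single (m - Poly_Mapping.single i (n i)) (1::'k)"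
      using single_add_le[OF i] by (simp add: Var_power mult_single)
    then show "Poly_Mapping.single m 1 \<in> J" using ideal_mult_left[OF id n] by simp
  qed
  then show ?thesis by (intro that[of "(\<Sum>i\<in>UNIV. n i) + 1"]) (auto simp: add.commute)
qed

lemma proj_points_adjoin:
  assumes "is_ideal I" "\<forall>P\<in>proj_points I. F \<notin> P"
  shows "proj_points (ideal_gen (I \<union> {F})) = {}"
  using assms subset_adjoin[of I F] adjoined_mem[of F I] by (fastforce simp: proj_points_def)

section \<open>Saturated ideals and nonzerodivisors\<close>

text \<open>
  A form \<open>L\<close> that misses all points is a nonzerodivisor modulo a saturated ideal, by a direct argument
  that replaces associated primes: the ideal \<open>I + (L)\<close> contains all forms \<open>g\<close> of some large degree, and
  \<open>(I + (L)) f \<subseteq> I\<close> when \<open>L f \<in> I\<close>. So \<open>g f \<in> I\<close> for all these \<open>g\<close>, and saturation gives \<open>f \<in> I\<close>.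
\<close>

lemma saturated_nonzerodivisor:
  assumes I: "homogeneous_ideal I" "saturated I" and L: "L \<in> forms e"
    and "\<forall>P\<in>proj_points I. L \<notin> P" and Lf: "L * f \<in> I"
  shows "f \<in> I"
proof -
  note id = homogeneous_is_ideal[OF I(1)]
  have "proj_points (ideal_gen (I \<union> {L})) = {}"
    using assms(4) by (rule proj_points_adjoin[OF id])
  from contains_high_forms[OF homogeneous_adjoin[OF I(1) L] this]
  obtain N where N: "\<And>t. t \<ge> int N \<Longrightarrow> forms t \<subseteq> ideal_gen (I \<union> {L})" by blast
  have "g * f \<in> I" if g: "g \<in> forms (int N)" for g
  proof -
    have "g \<in> ideal_gen (I \<union> {L})" using N[OF order_refl] g by (rule subsetD)
    then obtain h where h: "g - h * L \<in> I" unfolding mem_adjoin_iff[OF id] by (elim exE)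
    have "(g - h * L) * f + h * (L * f) \<in> I"
      by (intro ideal_add[OF id] ideal_mult_left[OF id h] ideal_mult[OF id Lf])
    then show ?thesis by (simp add: algebra_simps)
  qed
  then have "\<exists>n::nat. \<forall>g\<in>forms (int n). g * f \<in> I" by (intro exI ballI)
  then show ?thesis using I(2) unfolding saturated_def by (elim allE impE)
qed

section \<open>Polynomials as a vector space, and the Artinian condition\<close>

interpretation poly_space: vector_space "\<lambda>(c::'k::field) (p::('n::finite, 'k) mpoly). Const c * p"
  by unfold_locales (simp_all add: Const_add Const_mult algebra_simps)

lemma ideal_poly_subspace: "is_ideal K \<Longrightarrow> poly_space.subspace K"
  by (auto intro: poly_space.subspaceI ideal_zero ideal_add ideal_mult)

lemma finite_monomials_below: "finite {m :: 'n::finite \<Rightarrow>\<^sub>0 nat. monom_degree m < N}"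
proof -
  have "finite {f :: 'n \<Rightarrow> nat. \<forall>x. (x \<in> UNIV \<longrightarrow> f x \<in> {..<N}) \<and> (x \<notin> UNIV \<longrightarrow> f x = 0)}"
    by (rule finite_set_of_finite_funs) auto
  moreover have "Poly_Mapping.lookup m i < N" if "monom_degree m < N" for i and m :: "'n \<Rightarrow>\<^sub>0 nat"
    using that member_le_sum[of i UNIV "Poly_Mapping.lookup m"] unfolding monom_degree_def by auto
  then have "Poly_Mapping.lookup ` {m :: 'n \<Rightarrow>\<^sub>0 nat. monom_degree m < N} \<subseteq>
      {f. \<forall>x. (x \<in> UNIV \<longrightarrow> f x \<in> {..<N}) \<and> (x \<notin> UNIV \<longrightarrow> f x = 0)}"
    by (intro subsetI) auto
  ultimately have "finite (Poly_Mapping.lookup ` {m :: 'n \<Rightarrow>\<^sub>0 nat. monom_degree m < N})"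
    by (rule finite_subset[rotated])
  then show ?thesis
    by (rule finite_imageD) (auto intro!: inj_onI poly_mapping_eqI)
qed

lemma mem_span_monomials:
  fixes p :: "('n::finite, 'k::field) mpoly"
  assumes "\<And>m. m \<in> Poly_Mapping.keys p \<Longrightarrow> Poly_Mapping.single m 1 \<in> poly_space.span W"
  shows "p \<in> poly_space.span W"
proof -
  have "(\<Sum>m\<in>Poly_Mapping.keys p. Const (Poly_Mapping.lookup p m) * Poly_Mapping.single m 1)
      \<in> poly_space.span W"
    using assms by (intro poly_space.span_sum poly_space.span_scale) auto
  then show ?thesis by (simp add: Const_mult_single sum_monomials)
qed

text \<open>
  Ideals containing \<open>J\<close> are determined by their intersections with the finite-dimensional space spanned by
  the monomials of degree below \<open>N\<close>. In a descending chain, take an intersection with a smallest basis;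
  the later ones cannot shrink any further.
\<close>

lemma artinian_if_contains_high_forms:
  fixes J :: "('n::finite, 'k::field) mpoly set"
  assumes id: "is_ideal J" and N: "\<And>t. t \<ge> int N \<Longrightarrow> forms t \<subseteq> J"
  shows "artinian_quotient J"
  unfolding artinian_quotient_def
proof (intro allI impI)
  fix C :: "nat \<Rightarrow> ('n, 'k) mpoly set"
  assume "\<forall>n. is_ideal (C n) \<and> J \<subseteq> C n \<and> C (Suc n) \<subseteq> C n"
  then have CI: "is_ideal (C n)" and JC: "J \<subseteq> C n" and step: "C (Suc n) \<subseteq> C n" for n by auto
  have dec: "C n \<subseteq> C m" if "m \<le> n" for m n
    using step that by (rule lift_Suc_antimono_le)
  define W :: "('n, 'k) mpoly set"
    where "W = (\<lambda>m. Poly_Mapping.single m 1) ` {m. monom_degree m < N}"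
  have finW: "finite W" unfolding W_def by (intro finite_imageI finite_monomials_below)
  have low: "\<exists>w\<in>poly_space.span W. p - w \<in> J" for p
  proof -
    \<comment> \<open>Truncation below degree \<open>N\<close> does not change \<open>p\<close> modulo \<open>J\<close>.\<close>
    define w where "w = (\<Sum>n<N. component (int n) p)"
    have lw: "Poly_Mapping.lookup w m = (if monom_degree m < N then Poly_Mapping.lookup p m else 0)" for m
      by (auto simp: w_def lookup_sum lookup_component)
    have "w \<in> poly_space.span W"
      by (rule mem_span_monomials, rule poly_space.span_base) (auto simp: W_def in_keys_iff lw split: if_splits)
    moreover have "p - w \<in> J"
    proof (rule mem_ideal_monomials[OF id])
      fix m assume "m \<in> Poly_Mapping.keys (p - w)"
      then have "int (monom_degree m) \<ge> int N"
        by (auto simp: in_keys_iff lookup_minus lw split: if_splits)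
      then have "forms (int (monom_degree m)) \<subseteq> J" by (rule N)
      then show "Poly_Mapping.single m 1 \<in> J" by (rule subsetD) (simp add: forms_def)
    qed
    ultimately show ?thesis by blast
  qed
  define V where "V n = C n \<inter> poly_space.span W" for n
  have "\<exists>b. b \<subseteq> V n \<and> poly_space.independent b \<and> V n \<subseteq> poly_space.span b" for n
    by (rule poly_space.basis_exists[of "V n"]) (intro exI conjI)
  then obtain b where b: "\<And>n. b n \<subseteq> V n" "\<And>n. poly_space.independent (b n)" "\<And>n. V n \<subseteq> poly_space.span (b n)"
    by metis
  have bfin: "finite (b n)" for n
    using poly_space.independent_span_bound[OF finW b(2)] b(1) by (auto simp: V_def)
  obtain M where M: "\<And>n. card (b M) \<le> card (b n)"
    using ex_has_least_nat[of "\<lambda>_. True" 0 "\<lambda>n. card (b n)"] by blast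
  have "C n = C M" if n: "n \<ge> M" for n
  proof
    show "C n \<subseteq> C M" using dec n by blast
    have VV: "V n \<subseteq> V M" using dec[OF n] by (auto simp: V_def)
    have bb: "b M \<subseteq> poly_space.span (b n)"
    proof
      fix x assume x: "x \<in> b M"
      show "x \<in> poly_space.span (b n)"
      proof (rule ccontr)
        assume nx: "x \<notin> poly_space.span (b n)"
        then have "x \<notin> b n" using poly_space.span_base by blast
        have "poly_space.independent (insert x (b n))"
          using nx b(2) by (simp add: poly_space.independent_insert)
        moreover have "insert x (b n) \<subseteq> poly_space.span (b M)"
          using x b(1)[of n] VV b(3)[of M] poly_space.span_base by blast
        ultimately have "card (insert x (b n)) \<le> card (b M)"
          using poly_space.independent_span_bound[OF bfin] by blast
        then show False using M[of n] bfin \<open>x \<notin> b n\<close> by simp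
      qed
    qed
    have "poly_space.span (b n) \<subseteq> C n"
      using b(1) by (intro poly_space.span_minimal ideal_poly_subspace CI) (auto simp: V_def)
    moreover have "poly_space.span (b M) \<subseteq> poly_space.span (b n)"
      using bb by (intro poly_space.span_minimal poly_space.subspace_span)
    ultimately have VC: "V M \<subseteq> C n" using b(3)[of M] by blast
    show "C M \<subseteq> C n"
    proof
      fix p assume p: "p \<in> C M"
      obtain w where w: "w \<in> poly_space.span W" "p - w \<in> J" using low by blast
      have "p - (p - w) \<in> C M" using ideal_minus[OF CI p] w(2) JC by blast
      then have "w \<in> C n" using VC w(1) by (auto simp: V_def)
      then have "w + (p - w) \<in> C n" using ideal_add[OF CI] w(2) JC by blast
      then show "p \<in> C n" by simp
    qed
  qed
  then show "\<exists>N. \<forall>n\<ge>N. C n = C N" by blast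
qed

section \<open>Finiteness of the set of points\<close>

lemma proj_points_incomparable:
  assumes dim: "proj_dim I = 0" and P: "P \<in> proj_points I" and Q: "Q \<in> proj_points I"
    and "P \<subseteq> Q"
  shows "P = Q"
proof (rule ccontr)
  assume "P \<noteq> Q"
  then have "(\<forall>i\<le>1. (if i = 0 then P else Q) \<in> proj_points I) \<and>
      (\<forall>i<1. (if i = 0 then P else Q) \<subset> (if Suc i = 0 then P else Q))"
    using assms by auto
  then have "ereal (real 1) \<in> {ereal (real n) | n. \<exists>P. (\<forall>i\<le>n. P i \<in> proj_points I) \<and> (\<forall>i<n. P i \<subset> P (Suc i))}"
    by (intro CollectI exI[of _ 1] conjI exI[of _ "\<lambda>i. if i = 0 then P else Q"]) auto
  then have "ereal (real 1) \<le> proj_dim I"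
    unfolding proj_dim_def by (rule Sup_upper)
  then show False using dim by simp
qed

lemma proj_points_nonempty:
  assumes "proj_dim I = 0"
  shows "proj_points I \<noteq> {}"
proof
  assume "proj_points I = {}"
  then have "{ereal (real n) | n. \<exists>P. (\<forall>i\<le>n. P i \<in> proj_points I) \<and> (\<forall>i<n. P i \<subset> P (Suc i))} = {}"
    by auto
  then have "proj_dim I = -\<infinity>"
    unfolding proj_dim_def by (simp only: Sup_empty bot_ereal_def)
  then show False using assms by simp
qed

text \<open>
  The Hilbert function of \<open>R/I\<close> is bounded: modulo \<open>I\<close>, a form of degree at least \<open>N\<close> is a multiple of \<open>F\<close>,
  so by induction the forms of degree \<open>t\<close> are spanned by products of a power of \<open>F\<close> and a monomial of degree
  below \<open>N\<close>. The number of these products is bounded independently of \<open>t\<close>.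
\<close>

lemma forms_spanned_by_powers:
  fixes I :: "('n::finite, 'k::field) mpoly set"
  assumes I: "homogeneous_ideal I" and F: "F \<in> forms e" and e: "e > 0"
    and N: "\<And>t. t \<ge> int N \<Longrightarrow> forms t \<subseteq> ideal_gen (I \<union> {F})" and "N > 0"
    and p: "p \<in> forms t"
  shows "\<exists>w\<in>poly_space.span ((\<lambda>m. F ^ nat ((t - int (monom_degree m)) div e) * Poly_Mapping.single m 1) `
           {m. monom_degree m < N \<and> int (monom_degree m) \<le> t}). p - w \<in> I"
  using p
proof (induction "nat t" arbitrary: t p rule: less_induct)
  case less
  note id = homogeneous_is_ideal[OF I]
  define S where "S t = (\<lambda>m. F ^ nat ((t - int (monom_degree m)) div e) * Poly_Mapping.single m (1::'k)) `
           {m. monom_degree m < N \<and> int (monom_degree m) \<le> t}" for t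
  have "\<exists>w\<in>poly_space.span (S t). p - w \<in> I"
  proof (cases "t < int N")
    case True
    have "p \<in> poly_space.span (S t)"
    proof (rule mem_span_monomials, rule poly_space.span_base)
      fix m assume "m \<in> Poly_Mapping.keys p"
      then have "int (monom_degree m) = t" using less.prems by (auto simp: forms_def)
      then show "Poly_Mapping.single m 1 \<in> S t"
        using True by (auto simp: S_def intro!: image_eqI[of _ _ m])
    qed
    then show ?thesis using ideal_zero[OF id] by (intro bexI[of _ p]) auto
  next
    case False
    then have "p \<in> ideal_gen (I \<union> {F})" using N[of t] less.prems by auto
    with form_mem_adjoin[OF I F less.prems] obtain h
      where h: "h \<in> forms (t - e)" "p - h * F \<in> I" by metis
    have "nat (t - e) < nat t" using e False \<open>N > 0\<close> by linarith
    from less.hyps[OF this h(1)] obtain w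
      where w: "w \<in> poly_space.span (S (t - e))" "h - w \<in> I" by (auto simp: S_def)
    have step: "F * x \<in> S t" if x: "x \<in> S (t - e)" for x
    proof -
      obtain m where m: "monom_degree m < N" "int (monom_degree m) \<le> t - e"
        "x = F ^ nat ((t - e - int (monom_degree m)) div e) * Poly_Mapping.single m 1"
        using x by (auto simp: S_def)
      define q where "q = (t - e - int (monom_degree m)) div e"
      have "q \<ge> 0" using m(2) e by (simp add: q_def pos_imp_zdiv_nonneg_iff)
      have "t - int (monom_degree m) = (t - e - int (monom_degree m)) + e" by simp
      then have "(t - int (monom_degree m)) div e = q + 1"
        using e by (simp only: q_def div_add_self2)
      then have "F * x = F ^ nat ((t - int (monom_degree m)) div e) * Poly_Mapping.single m 1"
        using \<open>q \<ge> 0\<close> by (simp add: m(3) q_def[symmetric] nat_add_distrib mult.assoc)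
      then show ?thesis using m(1,2) e by (auto simp: S_def)
    qed
    have "F * w \<in> poly_space.span (S t)"
      using w(1)
    proof (induction rule: poly_space.span_induct_alt)
      case base
      show ?case by (simp add: poly_space.span_zero)
    next
      case (step c x y)
      have "F * (Const c * x + y) = Const c * (F * x) + F * y" by (simp add: algebra_simps)
      then show ?case
        using step \<open>\<And>x. x \<in> S (t - e) \<Longrightarrow> F * x \<in> S t\<close>
        by (simp add: poly_space.span_add poly_space.span_scale poly_space.span_base)
    qed
    moreover have "p - F * w \<in> I"
      using ideal_add[OF id h(2) ideal_mult[OF id w(2), of F]] by (simp add: algebra_simps)
    ultimately show ?thesis by blast
  qed
  then show ?case by (simp add: S_def)
qed

text \<open>
  For each of the other primes choose a form in it but not in \<open>P\<close>, and multiply; a variable outside \<open>P\<close> serves to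
  raise the degree, so that forms for different \<open>P\<close> can later be chosen of the same degree.
\<close>

lemma forms_separating_a_point:
  assumes P: "P \<in> proj_points I" and \<P>: "finite \<P>" "\<P> \<subseteq> proj_points I"
    and nsub: "\<And>Q. Q \<in> \<P> \<Longrightarrow> Q \<noteq> P \<Longrightarrow> \<not> Q \<subseteq> P"
  obtains T where "\<And>t. t \<ge> T \<Longrightarrow> \<exists>g\<in>forms t. g \<notin> P \<and> (\<forall>Q\<in>\<P> - {P}. g \<in> Q)"
proof -
  have Pp: "is_prime_ideal P" using P by (simp add: proj_points_def)
  have "\<exists>f d. f \<in> forms d \<and> f \<in> Q \<and> f \<notin> P" if Q: "Q \<in> \<P> - {P}" for Q
  proof (rule ccontr)
    assume *: "\<nexists>f d. f \<in> forms d \<and> f \<in> Q \<and> f \<notin> P"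
    have hQ: "homogeneous_ideal Q" using Q \<P>(2) by (auto simp: proj_points_def)
    have iP: "is_ideal P" using Pp by (simp add: is_prime_ideal_def)
    have "f \<in> P" if f: "f \<in> Q" for f
    proof -
      obtain N where N: "(\<Sum>n\<le>N. component (int n) f) = f" using ex_sum_components by blast
      have "component (int n) f \<in> P" for n
        using * homogeneous_component[OF hQ f] component_in_forms by blast
      then have "(\<Sum>n\<le>N. component (int n) f) \<in> P" by (simp add: ideal_sum[OF iP])
      then show ?thesis by (simp add: N)
    qed
    then show False using nsub Q by blast
  qed
  then obtain f d where f: "\<And>Q. Q \<in> \<P> - {P} \<Longrightarrow> f Q \<in> forms (d Q) \<and> f Q \<in> Q \<and> f Q \<notin> P"
    by metis
  define h where "h = prod f (\<P> - {P})"
  have hf: "h \<in> forms (sum d (\<P> - {P}))" unfolding h_def using f by (intro forms_prod) blast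
  have prodP: "prod f A \<notin> P" if "finite A" "A \<subseteq> \<P> - {P}" for A
    using that
  proof (induction A rule: finite_induct)
    case empty
    then show ?case using Pp ideal_mult[of P 1] by (auto simp: is_prime_ideal_def)
  next
    case (insert Q A)
    then show ?case using Pp f by (auto simp: is_prime_ideal_def)
  qed
  have hP: "h \<notin> P" unfolding h_def using \<P>(1) by (intro prodP) auto
  have hQ: "h \<in> Q" if Q: "Q \<in> \<P> - {P}" for Q
  proof -
    have "h = f Q * prod f (\<P> - {P} - {Q})" unfolding h_def using \<P>(1) Q by (intro prod.remove) auto
    moreover have "is_ideal Q" using Q \<P>(2) by (auto simp: proj_points_def is_prime_ideal_def)
    ultimately show ?thesis using f[OF Q] ideal_mult_left by metis
  qed
  obtain i where i: "Var i \<notin> P"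
    using P irrelevant_subset_iff[of P] by (auto simp: proj_points_def is_prime_ideal_def)
  show ?thesis
  proof (rule that[of "sum d (\<P> - {P})"])
    fix t assume t: "t \<ge> sum d (\<P> - {P})"
    define n where "n = nat (t - sum d (\<P> - {P}))"
    define g where "g = h * Var i ^ n"
    have "g \<in> forms t"
      using forms_mult[OF hf forms_power[OF Var_in_forms, of i n]] t by (simp add: g_def n_def)
    moreover have "g \<notin> P"
      using hP i Pp prime_ideal_power[OF Pp] by (auto simp: g_def is_prime_ideal_def)
    moreover have "g \<in> Q" if Q: "Q \<in> \<P> - {P}" for Q
    proof -
      have "is_ideal Q" using Q \<P>(2) by (auto simp: proj_points_def is_prime_ideal_def)
      then show ?thesis unfolding g_def using hQ[OF Q] by (rule ideal_mult_left)
    qed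
    ultimately show "\<exists>g\<in>forms t. g \<notin> P \<and> (\<forall>Q\<in>\<P> - {P}. g \<in> Q)" by blast
  qed
qed

text \<open>
  In dimension zero the prime of a point contains no other such prime, so finitely many points have separating forms of a common
  degree. These are linearly independent modulo \<open>I\<close>, so the bound on the Hilbert function of \<open>R/I\<close> bounds the
  number of points.
\<close>

lemma finite_points:
  fixes I :: "('n::finite, 'k::field) mpoly set"
  assumes I: "homogeneous_ideal I" and dim: "proj_dim I = 0"
    and F: "F \<in> forms e" "e > 0" and FP: "\<forall>P\<in>proj_points I. F \<notin> P"
  shows "finite (proj_points I)"
proof (rule ccontr)
  note id = homogeneous_is_ideal[OF I]
  assume inf: "infinite (proj_points I)"
  from contains_high_forms[OF homogeneous_adjoin[OF I F(1)] proj_points_adjoin[OF id FP]]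
  obtain N0 where N0: "\<And>t. t \<ge> int N0 \<Longrightarrow> forms t \<subseteq> ideal_gen (I \<union> {F})" by metis
  \<comment> \<open>A positive bound, so that subtracting \<open>e\<close> from a degree at least \<open>N\<close> is a descent in the naturals.\<close>
  define N where "N = Suc N0"
  have N: "forms t \<subseteq> ideal_gen (I \<union> {F})" if "t \<ge> int N" for t
    using N0[of t] that by (simp add: N_def)
  define D where "D = {m :: 'n \<Rightarrow>\<^sub>0 nat. monom_degree m < N}"
  have finD: "finite D" unfolding D_def by (rule finite_monomials_below)
  obtain \<P> where \<P>: "card \<P> = Suc (card D)" "finite \<P>" "\<P> \<subseteq> proj_points I"
    using infinite_arbitrarily_large[OF inf] by blast
  have "\<exists>T. \<forall>t\<ge>T. \<exists>g\<in>forms t. g \<notin> P \<and> (\<forall>Q\<in>\<P> - {P}. g \<in> Q)" if P: "P \<in> \<P>" for P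
  proof -
    have "P \<in> proj_points I" using P \<P>(3) by blast
    moreover have "\<not> Q \<subseteq> P" if "Q \<in> \<P>" "Q \<noteq> P" for Q
      using proj_points_incomparable[OF dim] that \<P>(3) \<open>P \<in> proj_points I\<close> by blast
    ultimately show ?thesis using forms_separating_a_point[OF _ \<P>(2,3)] by metis
  qed
  then obtain T where T: "\<And>P t. P \<in> \<P> \<Longrightarrow> t \<ge> T P \<Longrightarrow> \<exists>g\<in>forms t. g \<notin> P \<and> (\<forall>Q\<in>\<P> - {P}. g \<in> Q)"
    by metis
  define t where "t = Max (T ` \<P>)"
  have tT: "t \<ge> T P" if "P \<in> \<P>" for P using that \<P>(2) by (simp add: t_def)
  define S where "S = (\<lambda>m. F ^ nat ((t - int (monom_degree m)) div e) * Poly_Mapping.single m (1::'k)) `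
           {m. monom_degree m < N \<and> int (monom_degree m) \<le> t}"
  have sub: "{m :: 'n \<Rightarrow>\<^sub>0 nat. monom_degree m < N \<and> int (monom_degree m) \<le> t} \<subseteq> D"
    by (auto simp: D_def)
  have finS: "finite S" unfolding S_def using finite_subset[OF sub finD] by (rule finite_imageI)
  have "card S \<le> card {m :: 'n \<Rightarrow>\<^sub>0 nat. monom_degree m < N \<and> int (monom_degree m) \<le> t}"
    unfolding S_def using finite_subset[OF sub finD] by (rule card_image_le)
  also have "\<dots> \<le> card D" using finD sub by (rule card_mono)
  finally have cardS: "card S \<le> card D" .
  have "\<exists>w\<in>poly_space.span S. w \<notin> P \<and> (\<forall>Q\<in>\<P> - {P}. w \<in> Q)" if P: "P \<in> \<P>" for P
  proof -
    obtain g where g: "g \<in> forms t" "g \<notin> P" "\<forall>Q\<in>\<P> - {P}. g \<in> Q" using T[OF P tT[OF P]] by blast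
    have "\<exists>w\<in>poly_space.span S. g - w \<in> I"
      unfolding S_def using forms_spanned_by_powers[OF I F N _ g(1)] by (simp add: N_def)
    then obtain w where w: "w \<in> poly_space.span S" "g - w \<in> I" by blast
    \<comment> \<open>Every point contains \<open>I\<close>, so passing from \<open>g\<close> to \<open>w\<close> keeps the separation property.\<close>
    have iff: "g \<in> Q \<longleftrightarrow> w \<in> Q" if Q: "Q \<in> \<P>" for Q
    proof -
      have iQ: "is_ideal Q" and "g - w \<in> Q"
        using Q \<P>(3) w(2) by (auto simp: proj_points_def is_prime_ideal_def)
      then show ?thesis
        using ideal_add[OF iQ, of "g - w" w] ideal_minus[OF iQ, of g "g - w"] by auto
    qed
    show ?thesis using g iff P w(1) by (intro bexI[of _ w]) auto
  qed
  then obtain w where w: "\<And>P. P \<in> \<P> \<Longrightarrow> w P \<in> poly_space.span S" "\<And>P. P \<in> \<P> \<Longrightarrow> w P \<notin> P"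
    "\<And>P Q. P \<in> \<P> \<Longrightarrow> Q \<in> \<P> \<Longrightarrow> Q \<noteq> P \<Longrightarrow> w P \<in> Q" by (metis DiffI singletonD)
  have inj: "inj_on w \<P>" using w by (metis inj_onI)
  \<comment> \<open>The other forms lie in the subspace \<open>P\<close>, so their span does, and \<open>w P\<close> is outside it.\<close>
  have "poly_space.independent (w ` \<P>)"
    unfolding poly_space.dependent_def
  proof
    assume "\<exists>a\<in>w ` \<P>. a \<in> poly_space.span (w ` \<P> - {a})"
    then obtain P where P: "P \<in> \<P>" "w P \<in> poly_space.span (w ` \<P> - {w P})" by blast
    have "is_ideal P" using P(1) \<P>(3) by (auto simp: proj_points_def is_prime_ideal_def)
    moreover have "w ` \<P> - {w P} \<subseteq> P" using w(3) P(1) by blast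
    ultimately have "w P \<in> P" using P(2) poly_space.span_minimal ideal_poly_subspace by blast
    then show False using w(2) P(1) by blast
  qed
  moreover have "w ` \<P> \<subseteq> poly_space.span S" using w(1) by blast
  ultimately have "card (w ` \<P>) \<le> card S" using poly_space.independent_span_bound[OF finS] by blast
  then show False using cardS \<P>(1) card_image[OF inj] by simp
qed

section \<open>A general linear form avoids finitely many points\<close>

definition monom_eval :: "('n::finite \<Rightarrow> 'k::field) \<Rightarrow> ('n \<Rightarrow>\<^sub>0 nat) \<Rightarrow> 'k" where
  "monom_eval c m = (\<Prod>i\<in>UNIV. c i ^ Poly_Mapping.lookup m i)"

lemma eval_superset:
  assumes "finite A" "Poly_Mapping.keys p \<subseteq> A"
  shows "eval p c = (\<Sum>m\<in>A. Poly_Mapping.lookup p m * monom_eval c m)"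
  unfolding eval_def monom_eval_def
  using assms by (intro sum.mono_neutral_left) (auto simp: in_keys_iff)

lemma eval_zero [simp]: "eval 0 c = 0"
  by (simp add: eval_def)

lemma eval_add: "eval (p + q) c = eval p c + eval q c"
proof -
  let ?A = "Poly_Mapping.keys p \<union> Poly_Mapping.keys q"
  show ?thesis
    using keys_add[of p q]
    by (simp add: eval_superset[of ?A] lookup_add distrib_right sum.distrib)
qed

lemma eval_sum: "eval (sum f A) c = (\<Sum>x\<in>A. eval (f x) c)"
  by (induction A rule: infinite_finite_induct) (simp_all add: eval_add)

lemma eval_single: "eval (Poly_Mapping.single m a) c = a * monom_eval c m"
  by (simp add: eval_superset[of "{m}"])

lemma monom_eval_add: "monom_eval c (m + m') = monom_eval c m * monom_eval c m'"
  by (simp add: monom_eval_def lookup_add power_add prod.distrib)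

lemma eval_mult: "eval (p * q) c = eval p c * eval q c"
proof -
  have "eval (p * q) c = eval ((\<Sum>m\<in>Poly_Mapping.keys p. Poly_Mapping.single m (Poly_Mapping.lookup p m)) *
      (\<Sum>m\<in>Poly_Mapping.keys q. Poly_Mapping.single m (Poly_Mapping.lookup q m))) c"
    by (simp add: sum_monomials)
  also have "\<dots> = (\<Sum>m\<in>Poly_Mapping.keys p. Poly_Mapping.lookup p m * monom_eval c m) *
      (\<Sum>m\<in>Poly_Mapping.keys q. Poly_Mapping.lookup q m * monom_eval c m)"
    by (simp add: sum_product eval_sum mult_single eval_single monom_eval_add ac_simps)
  finally show ?thesis by (simp add: eval_superset[of "Poly_Mapping.keys p" p] eval_superset[of "Poly_Mapping.keys q" q])
qed

lemma eval_one [simp]: "eval 1 c = 1"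
  using eval_single[of 0 1 c] by (simp add: monom_eval_def)

lemma eval_prod: "eval (prod f A) c = (\<Prod>x\<in>A. eval (f x) c)"
  by (induction A rule: infinite_finite_induct) (simp_all add: eval_mult)

lemma eval_Var: "eval (Var i) c = c i"
proof -
  have "monom_eval c (Poly_Mapping.single i 1) = (\<Prod>j\<in>UNIV. if j = i then c i else 1)"
    unfolding monom_eval_def by (intro prod.cong) (auto simp: lookup_single when_def)
  then show ?thesis by (simp add: Var_def eval_single)
qed

lemma eval_Const: "eval (Const a) c = a"
  by (simp add: Const_def eval_single monom_eval_def)

lemma eval_linear_form: "eval (linear_form l) c = (\<Sum>i\<in>UNIV. l i * c i)"
  by (simp add: linear_form_def eval_sum eval_mult eval_Var eval_Const)

interpretation poly_functional: vector_space_pair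
  "\<lambda>(c::'k::field) (p::('n::finite, 'k) mpoly). Const c * p" "(*) :: 'k \<Rightarrow> 'k \<Rightarrow> 'k"
  by unfold_locales (simp_all add: algebra_simps)

text \<open>
  A proper subspace lies in the kernel of a nonzero functional. Take a functional on the polynomial ring
  that kills \<open>P\<close> but not some variable, and read off its values on the variables.
\<close>

lemma linear_forms_in_hyperplane:
  fixes P :: "('n::finite, 'k::field) mpoly set"
  assumes P: "is_ideal P" "\<not> irrelevant_ideal \<subseteq> P"
  obtains l :: "'n \<Rightarrow> 'k" where "l \<noteq> (\<lambda>_. 0)"
    "\<And>c. linear_form c \<in> P \<Longrightarrow> (\<Sum>i\<in>UNIV. l i * c i) = 0"
proof -
  obtain i where i: "Var i \<notin> P" using P irrelevant_subset_iff by blast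
  obtain B where B: "B \<subseteq> P" "poly_space.independent B" "P \<subseteq> poly_space.span B"
    by (rule poly_space.basis_exists[of P])
  have "poly_space.span B \<subseteq> P" using B(1) ideal_poly_subspace[OF P(1)] by (rule poly_space.span_minimal)
  then have "poly_space.independent (insert (Var i) B)"
    using i B(2) by (auto simp: poly_space.independent_insert)
  from poly_functional.linear_independent_extend[OF this, of "\<lambda>x. if x = Var i then 1 else 0"]
  obtain \<phi> where lin: "Vector_Spaces.linear (\<lambda>c p. Const c * p) (*) \<phi>"
    and \<phi>: "\<forall>x\<in>insert (Var i) B. \<phi> x = (if x = Var i then 1 else (0::'k))" by blast
  have "\<phi> x = 0" if "x \<in> B" for x using \<phi> that i B(1) by auto
  then have \<phi>P: "\<phi> x = 0" if "x \<in> P" for x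
    using poly_functional.linear_eq_0_on_span[OF lin, of B x] that B(3) by blast
  define l where "l j = \<phi> (Var j)" for j
  have "\<phi> (linear_form c) = (\<Sum>j\<in>UNIV. l j * c j)" for c
    unfolding linear_form_def l_def
    by (simp add: poly_functional.linear_sum[OF lin] poly_functional.linear_scale[OF lin] mult.commute[of "\<phi> _"])
  moreover have "l i = 1" using \<phi> by (simp add: l_def)
  ultimately show ?thesis using that[of l] \<phi>P by (metis zero_neq_one)
qed

text \<open>
  The moment curve \<open>s \<mapsto> (1, s, s\<^sup>2, \<dots>)\<close> meets each hyperplane in finitely many points, the roots of a nonzero
  polynomial in \<open>s\<close>.
\<close>

lemma ex_point_off_hyperplanes:
  fixes H :: "('n::finite \<Rightarrow> 'k::field) set"
  assumes inf: "infinite (UNIV :: 'k set)"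
    and "finite H" and H: "\<And>l. l \<in> H \<Longrightarrow> l \<noteq> (\<lambda>_. 0)"
  obtains c :: "'n \<Rightarrow> 'k" where "\<And>l. l \<in> H \<Longrightarrow> (\<Sum>i\<in>UNIV. l i * c i) \<noteq> 0"
proof -
  obtain ix :: "'n \<Rightarrow> nat" where ix: "inj ix"
    using finite_imp_inj_to_nat_seg[OF finite_class.finite_UNIV] by blast
  define q where "q l = (\<Sum>i\<in>UNIV. monom (l i) (ix i))" for l :: "'n \<Rightarrow> 'k"
  have "q l \<noteq> 0" if l: "l \<in> H" for l
  proof -
    obtain i where i: "l i \<noteq> 0" using H[OF l] by auto
    have "coeff (q l) (ix i) = (\<Sum>j\<in>UNIV. if j = i then l i else 0)"
      unfolding q_def coeff_sum using ix by (intro sum.cong) (auto simp: inj_eq)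
    then show ?thesis using i by auto
  qed
  then have "finite (\<Union>l\<in>H. {s. poly (q l) s = 0})"
    using \<open>finite H\<close> by (intro finite_UN_I poly_roots_finite)
  then obtain s where s: "s \<notin> (\<Union>l\<in>H. {s. poly (q l) s = 0})"
    using inf ex_new_if_finite by blast
  have "poly (q l) s = (\<Sum>i\<in>UNIV. l i * s ^ ix i)" for l
    by (simp add: q_def poly_sum poly_monom)
  then show ?thesis using s that[of "\<lambda>i. s ^ ix i"] by auto
qed

text \<open>
  The open set is the complement of finitely many hyperplanes, which is the locus where a product of
  linear forms does not vanish.
\<close>

lemma general_linear_form_avoids:
  fixes \<P> :: "('n::finite, 'k::field) mpoly set set"
  assumes inf: "infinite (UNIV :: 'k set)" and fin: "finite \<P>"
    and \<P>: "\<And>P. P \<in> \<P> \<Longrightarrow> is_ideal P" "\<And>P. P \<in> \<P> \<Longrightarrow> \<not> irrelevant_ideal \<subseteq> P"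
  shows "for_general_linear_form (\<lambda>L. \<forall>P\<in>\<P>. L \<notin> P)"
proof -
  have "\<forall>P\<in>\<P>. \<exists>l. l \<noteq> (\<lambda>_. 0) \<and> (\<forall>c. linear_form c \<in> P \<longrightarrow> (\<Sum>i\<in>UNIV. l i * c i) = 0)"
    using linear_forms_in_hyperplane[OF \<P>] by metis
  then obtain l where l: "\<And>P. P \<in> \<P> \<Longrightarrow> l P \<noteq> (\<lambda>_. 0)"
    "\<And>P c. P \<in> \<P> \<Longrightarrow> linear_form c \<in> P \<Longrightarrow> (\<Sum>i\<in>UNIV. l P i * c i) = 0"
    by metis
  define h where "h = (\<Prod>P\<in>\<P>. linear_form (l P))"
  have h: "eval h c = 0 \<longleftrightarrow> (\<exists>P\<in>\<P>. (\<Sum>i\<in>UNIV. l P i * c i) = 0)" for c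
    using fin by (simp add: h_def eval_prod eval_linear_form)
  have nz: "f \<noteq> (\<lambda>_. 0)" if "f \<in> l ` \<P>" for f
    using l(1) that by auto
  obtain c where c: "\<And>f. f \<in> l ` \<P> \<Longrightarrow> (\<Sum>i\<in>UNIV. f i * c i) \<noteq> 0"
    using ex_point_off_hyperplanes[OF inf finite_imageI[OF fin] nz] by blast
  show ?thesis
    unfolding for_general_linear_form_def
  proof (intro exI conjI ballI)
    show "zariski_closed (- {c. eval h c \<noteq> 0})"
      unfolding zariski_closed_def by (intro exI[of _ "{h}"]) auto
    have "eval h c \<noteq> 0" unfolding h using c by auto
    then show "{c. eval h c \<noteq> 0} \<noteq> {}" by auto
    fix c P assume "c \<in> {c. eval h c \<noteq> 0}" "P \<in> \<P>"
    then show "linear_form c \<notin> P" using h l(2)[of P c] by auto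
  qed
qed

section \<open>Coordinates and a linear form as a regular sequence\<close>

text \<open>
  Ideals generated by variables are monomial ideals. This reduces the regularity statements of this
  section to inspecting exponents.
\<close>

lemma mem_ideal_gen_Vars_iff:
  fixes p :: "('n::finite, 'k::field) mpoly"
  shows "p \<in> ideal_gen (Var ` A) \<longleftrightarrow>
    (\<forall>m\<in>Poly_Mapping.keys p. \<exists>i\<in>A. Poly_Mapping.lookup m i > 0)"
proof
  assume "p \<in> ideal_gen (Var ` A)"
  then show "\<forall>m\<in>Poly_Mapping.keys p. \<exists>i\<in>A. Poly_Mapping.lookup m i > 0"
  proof (induction rule: self_module.span_induct_alt)
    case base
    show ?case by simp
  next
    case (step c x y)
    then obtain i where i: "i \<in> A" "x = Var i" by blast
    have "Poly_Mapping.lookup m i > 0" if "m \<in> Poly_Mapping.keys (c * x)" for m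
      using that keys_mult[of c x] by (auto simp: i(2) Var_def lookup_add)
    then show ?case using keys_add[of "c * x" y] step(2) i(1) by blast
  qed
next
  assume *: "\<forall>m\<in>Poly_Mapping.keys p. \<exists>i\<in>A. Poly_Mapping.lookup m i > 0"
  show "p \<in> ideal_gen (Var ` A)"
  proof (rule mem_ideal_monomials)
    fix m assume "m \<in> Poly_Mapping.keys p"
    then obtain i where i: "i \<in> A" "1 \<le> Poly_Mapping.lookup m i" using * by force
    have "Poly_Mapping.single m 1 =
        Poly_Mapping.single (m - Poly_Mapping.single i 1) (1::'k) * Var i"
      using single_add_le[OF i(2)] by (simp add: Var_def mult_single add.commute)
    then show "Poly_Mapping.single m 1 \<in> ideal_gen (Var ` A :: ('n, 'k) mpoly set)"
      using i(1) by (simp add: self_module.span_scale self_module.span_base)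
  qed simp
qed

lemma lookup_Var_mult:
  "Poly_Mapping.lookup (Var i * p) (Poly_Mapping.single i 1 + m) = Poly_Mapping.lookup p m"
proof -
  have "Var i * p = (\<Sum>m'\<in>Poly_Mapping.keys p.
      Poly_Mapping.single (Poly_Mapping.single i 1 + m') (Poly_Mapping.lookup p m'))"
    using arg_cong[OF sum_monomials[of p], of "(*) (Var i)"]
    by (simp add: sum_distrib_left Var_def mult_single)
  then show ?thesis
    by (auto simp: lookup_sum lookup_single when_def in_keys_iff)
qed

lemma Var_nonzerodivisor_mod_Vars:
  assumes "i \<notin> A" "Var i * p \<in> ideal_gen (Var ` A)"
  shows "p \<in> ideal_gen (Var ` A)"
  unfolding mem_ideal_gen_Vars_iff
proof
  fix m assume "m \<in> Poly_Mapping.keys p"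
  then have "Poly_Mapping.single i 1 + m \<in> Poly_Mapping.keys (Var i * p)"
    using lookup_Var_mult[of i p m] by (simp add: in_keys_iff)
  then obtain l where l: "l \<in> A" "Poly_Mapping.lookup (Poly_Mapping.single i 1 + m) l > 0"
    using assms(2) unfolding mem_ideal_gen_Vars_iff by blast
  moreover have "l \<noteq> i" using l(1) assms(1) by auto
  ultimately show "\<exists>i\<in>A. Poly_Mapping.lookup m i > 0"
    by (auto simp: lookup_add lookup_single when_def)
qed

lemma positive_form_in_irrelevant:
  assumes "p \<in> forms e" "e > 0"
  shows "p \<in> ideal_gen (range Var)"
  unfolding mem_ideal_gen_Vars_iff
proof
  fix m assume "m \<in> Poly_Mapping.keys p"
  then have "monom_degree m \<noteq> 0" using assms by (auto simp: forms_def)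
  then show "\<exists>i\<in>UNIV. Poly_Mapping.lookup m i > 0"
    unfolding monom_degree_def by (meson bot_nat_0.not_eq_extremum sum.neutral UNIV_I)
qed

lemma mem_ideal_gen_1: "p \<in> ideal_gen {x} \<longleftrightarrow> (\<exists>a. p = a * x)"
  unfolding self_module.span_insert self_module.span_empty by auto

lemma mem_ideal_gen_2: "p \<in> ideal_gen {x, y} \<longleftrightarrow> (\<exists>a b. p = a * x + b * y)"
  unfolding self_module.span_insert[of x "{y}"] mem_Collect_eq mem_ideal_gen_1
  by (auto simp: algebra_simps diff_eq_eq)

lemma mem_ideal_gen_3: "p \<in> ideal_gen {x, y, z} \<longleftrightarrow> (\<exists>a b c. p = a * x + b * y + c * z)"
  unfolding self_module.span_insert[of x "{y, z}"] mem_Collect_eq mem_ideal_gen_2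
  by (auto simp: algebra_simps diff_eq_eq)

lemma Var_neq_zero [simp]: "Var i \<noteq> (0 :: ('n::finite, 'k::field) mpoly)"
  by (simp add: Var_def flip: keys_eq_empty)

lemma Var_syzygy:
  fixes U W :: "(3, 'k::field) mpoly"
  assumes "j \<noteq> k" "Var k * U = Var j * W"
  obtains z where "U = Var j * z" "W = Var k * z"
proof -
  have "Var k * U \<in> ideal_gen (Var ` {j})"
    unfolding assms(2) by (simp add: mem_ideal_gen_1)
  then have "U \<in> ideal_gen (Var ` {j})"
    by (rule Var_nonzerodivisor_mod_Vars[rotated]) (use assms(1) in simp)
  then obtain z where z: "U = z * Var j" by (auto simp: mem_ideal_gen_1)
  then have "Var j * (Var k * z - W) = 0" using assms(2) by (simp add: algebra_simps)
  then have "W = Var k * z" by simp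
  then show ?thesis using that z by (simp add: mult.commute)
qed

text \<open>
  Since \<open>b i \<noteq> 0\<close>, the linear form \<open>L\<close> can replace \<open>Var i\<close> as a coordinate. The two remaining variables,
  called \<open>x\<close> and \<open>y\<close>, are coordinates on the line \<open>L = 0\<close>.
\<close>

locale hyperplane_coordinates =
  fixes i j k :: 3 and b :: "3 \<Rightarrow> 'k::field" and L :: "(3, 'k) mpoly"
  assumes UNIV: "UNIV = {i, j, k}" and distinct: "i \<noteq> j" "i \<noteq> k" "j \<noteq> k"
    and bi: "b i \<noteq> 0" and L: "L = linear_form b"
begin

abbreviation "x \<equiv> Var j :: (3, 'k) mpoly"
abbreviation "y \<equiv> Var k :: (3, 'k) mpoly"

lemma L_eq: "L = Const (b i) * Var i + Const (b j) * x + Const (b k) * y"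
  unfolding L linear_form_def UNIV using distinct by (simp add: add.assoc)

lemma Var_i_eq: "Var i = Const (inverse (b i)) * (L - Const (b j) * x - Const (b k) * y)"
proof -
  have "L - Const (b j) * x - Const (b k) * y = Const (b i) * Var i" by (simp add: L_eq)
  then have "Const (inverse (b i)) * (L - Const (b j) * x - Const (b k) * y)
      = (Const (inverse (b i)) * Const (b i)) * Var i" by (simp only: mult.assoc)
  also have "\<dots> = Var i" by (simp only: Const_inverse[OF bi] mult_1_left)
  finally show ?thesis by (rule sym)
qed

lemma L_neq_zero: "L \<noteq> 0"
proof
  assume L0: "L = 0"
  have "Var i = (- Const (inverse (b i)) * Const (b j)) * x + (- Const (inverse (b i)) * Const (b k)) * y"
    by (subst Var_i_eq) (simp add: L0 algebra_simps)
  then have "Var i \<in> ideal_gen (Var ` {j, k} :: (3, 'k) mpoly set)"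
    unfolding image_insert image_empty mem_ideal_gen_2 by blast
  then have "1 \<in> ideal_gen (Var ` {j, k} :: (3, 'k) mpoly set)"
    using Var_nonzerodivisor_mod_Vars[of i "{j, k}" 1] distinct by simp
  then show False unfolding mem_ideal_gen_Vars_iff by simp
qed

lemma positive_form_split:
  assumes "p \<in> forms e" "e > 0"
  shows "\<exists>u v w. p = u * x + v * y + w * L"
proof -
  have "p \<in> ideal_gen {Var i, x, y}"
    using positive_form_in_irrelevant[OF assms] by (simp add: UNIV)
  then obtain u v w where "p = u * Var i + v * x + w * y" by (auto simp: mem_ideal_gen_3)
  then have "p = (v - u * Const (inverse (b i)) * Const (b j)) * x
      + (w - u * Const (inverse (b i)) * Const (b k)) * y + (u * Const (inverse (b i))) * L"
    by (subst (asm) Var_i_eq) (simp add: algebra_simps)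
  then show ?thesis by blast
qed

lemma L_nonzerodivisor_mod_xy:
  assumes "L * S \<in> ideal_gen {x, y}"
  shows "S \<in> ideal_gen {x, y}"
proof -
  have "Const (inverse (b i)) * (L * S) \<in> ideal_gen {x, y}"
    by (rule self_module.span_scale[OF assms])
  moreover have "c * x \<in> ideal_gen {x, y}" "c * y \<in> ideal_gen {x, y}" for c
    by (rule self_module.span_scale, rule self_module.span_base, simp)+
  ultimately have "Const (inverse (b i)) * (L * S) - (Const (inverse (b i)) * Const (b j) * S) * x
      - (Const (inverse (b i)) * Const (b k) * S) * y \<in> ideal_gen {x, y}"
    by (intro self_module.span_diff)
  moreover have "Var i * S = Const (inverse (b i)) * (L * S)
      - (Const (inverse (b i)) * Const (b j) * S) * x
      - (Const (inverse (b i)) * Const (b k) * S) * y"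
    by (subst Var_i_eq) (simp add: algebra_simps)
  ultimately have "Var i * S \<in> ideal_gen (Var ` {j, k})" by simp
  then have "S \<in> ideal_gen (Var ` {j, k})"
    by (rule Var_nonzerodivisor_mod_Vars[rotated]) (use distinct in simp)
  then show ?thesis by simp
qed

text \<open>
  Exactness of the Koszul complex of \<open>(x, y, L)\<close> in the middle. As \<open>L\<close> is regular modulo \<open>(x, y)\<close>, the
  coefficient \<open>S\<close> lies in \<open>(x, y)\<close>; absorbing it leaves a syzygy of the two variables.
\<close>

lemma Koszul_exact:
  assumes "y * U - x * W + L * S = 0"
  obtains z s s' where "U = x * z - L * s'" "W = y * z + L * s"
proof -
  have "L * S = W * x + (- U) * y" using assms by (simp add: algebra_simps)
  then have "L * S \<in> ideal_gen {x, y}" unfolding mem_ideal_gen_2 by blast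
  then have "S \<in> ideal_gen {x, y}" by (rule L_nonzerodivisor_mod_xy)
  then obtain s s' where S: "S = s * x + s' * y" by (auto simp: mem_ideal_gen_2)
  have "y * (U + L * s') = x * (W - L * s)" using assms by (simp add: S algebra_simps)
  with distinct(3) obtain z where "U + L * s' = x * z" "W - L * s = y * z" by (rule Var_syzygy)
  then show ?thesis by (intro that[of z s' s]) (simp_all add: algebra_simps)
qed

text \<open>
  Regularity of \<open>x\<close> modulo \<open>L\<close> is replaced here by the symmetric condition on \<open>x\<close> and \<open>y\<close>, for
  which it suffices that \<open>L\<close> is a nonzerodivisor and that \<open>x\<close>, \<open>y\<close> have only the obvious syzygies.
\<close>

lemma L_dvd_if_multiples:
  assumes "x * q = L * \<alpha>" "y * q = L * \<beta>"
  shows "\<exists>\<gamma>. q = \<gamma> * L"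
proof -
  have "L * (y * \<alpha>) = y * (x * q)" using assms(1) by (simp add: mult.left_commute)
  also have "\<dots> = L * (x * \<beta>)" using assms(2) by (simp add: mult.left_commute)
  finally have "y * \<alpha> = x * \<beta>" using L_neq_zero by simp
  with distinct(3) obtain \<gamma> where "\<alpha> = x * \<gamma>" by (rule Var_syzygy)
  then have "x * q = x * (\<gamma> * L)" using assms(1) by (simp add: ac_simps)
  then have "q = \<gamma> * L" by simp
  then show ?thesis by (rule exI)
qed

end

section \<open>The hyperplane section vanishes in high degrees\<close>

lemma form_in_range:
  fixes g :: "nat \<Rightarrow> ('n::finite, 'k::field) mpoly"
  assumes g: "\<forall>i\<in>{1..r}. g i \<in> forms (d i)" and p: "p \<in> forms t" "p = (\<Sum>i=1..r. u i * g i)"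
  obtains u' where "\<And>i. u' i \<in> forms (t - d i)" "p = (\<Sum>i=1..r. u' i * g i)"
proof -
  have "p = component t (\<Sum>i=1..r. u i * g i)"
    using p by (simp add: forms_iff_component)
  also have "\<dots> = (\<Sum>i=1..r. component (t - d i) (u i) * g i)"
    unfolding component_sum using g by (intro sum.cong) (auto simp: component_mult)
  finally show ?thesis by (intro that[of "\<lambda>i. component (t - d i) (u i)"]) auto
qed

text \<open>
  The heart of the proof: the algebra \<open>R/(I + (L))\<close> has no socle in degrees \<open>t \<ge> max a - 1\<close>. Modulo
  \<open>L\<close>, write \<open>x f = \<Sum> u\<^sub>n g\<^sub>n\<close> and \<open>y f = \<Sum> w\<^sub>n g\<^sub>n\<close>. Then \<open>y u - x w\<close> is a syzygy of the generators, hence a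
  combination \<open>v M\<close> of the rows of \<open>M\<close> with \<open>v\<^sub>l\<close> of degree \<open>t + 2 - a\<^sub>l > 0\<close>. Positive degree allows
  \<open>v = p x + q y\<close>, so \<open>y (u - q M) = x (w + p M)\<close>. Hence \<open>u - q M = x z\<close> for some \<open>z\<close>, and since \<open>q M\<close> maps to zero,
  \<open>x f = x (\<Sum> z\<^sub>n g\<^sub>n)\<close>. The terms with \<open>L\<close> in the proof carry out this computation in \<open>R\<close>
  instead of \<open>R/(L)\<close>; that \<open>L\<close> is a nonzerodivisor modulo \<open>I\<close> lets the syzygies of the generators be used
  there.
\<close>

lemma (in hyperplane_coordinates) socle_descent:
  fixes I :: "(3, 'k) mpoly set" and g :: "nat \<Rightarrow> (3, 'k) mpoly"
  assumes hom: "homogeneous_ideal I" and nzd: "\<And>h. L * h \<in> I \<Longrightarrow> h \<in> I"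
    and g: "\<forall>n\<in>{1..r}. g n \<in> forms (d n)"
    and M: "\<forall>l\<in>{1..s}. \<forall>n\<in>{1..r}. M l n \<in> forms (a l - d n)"
    and gen: "I = range (\<lambda>u. \<Sum>n=1..r. u n * g n)"
    and syz: "\<And>u. (\<Sum>n=1..r. u n * g n) = 0 \<longleftrightarrow>
             (\<exists>v. \<forall>n\<in>{1..r}. u n = (\<Sum>l=1..s. v l * M l n))"
    and a: "\<forall>l\<in>{1..s}. a l \<le> t + 1"
    and f: "f \<in> forms t" and xf: "x * f \<in> ideal_gen (I \<union> {L})" and yf: "y * f \<in> ideal_gen (I \<union> {L})"
  shows "f \<in> ideal_gen (I \<union> {L})"
proof -
  note id = homogeneous_is_ideal[OF hom]
  have L1: "L \<in> forms 1" unfolding L by (rule linear_form_in_forms)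
  let ?G = "\<lambda>u. \<Sum>n=1..r. u n * g n"
  have genI: "?G u \<in> I" for u unfolding gen by (rule rangeI)
  have rep: "\<exists>u \<alpha>. (\<forall>n. u n \<in> forms (t + 1 - d n)) \<and> \<alpha> \<in> forms t \<and> p = ?G u + L * \<alpha>"
    if p: "p \<in> forms (t + 1)" "p \<in> ideal_gen (I \<union> {L})" for p
  proof -
    obtain \<alpha> where \<alpha>: "\<alpha> \<in> forms (t + 1 - 1)" "p - \<alpha> * L \<in> I" using form_mem_adjoin[OF hom L1 p] .
    then obtain u where u: "p - \<alpha> * L = ?G u" unfolding gen by blast
    have "\<alpha> \<in> forms t" using \<alpha>(1) by simp
    then have "p - \<alpha> * L \<in> forms (t + 1)" by (intro forms_minus p(1) forms_mult L1)
    from form_in_range[OF g this u] obtain u'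
      where u': "\<And>n. u' n \<in> forms (t + 1 - d n)" "p - \<alpha> * L = ?G u'" by blast
    have "p = ?G u' + L * \<alpha>" unfolding u'(2)[symmetric] by (simp add: mult.commute)
    then show ?thesis using u'(1) \<alpha>(1) by auto
  qed
  have "x * f \<in> forms (t + 1)" "y * f \<in> forms (t + 1)"
    using forms_mult[OF Var_in_forms f] by (simp_all add: add.commute)
  then obtain u \<alpha> w \<beta> where
    u: "\<And>n. u n \<in> forms (t + 1 - d n)" and \<alpha>: "\<alpha> \<in> forms t" and xf_eq: "x * f = ?G u + L * \<alpha>" and
    w: "\<And>n. w n \<in> forms (t + 1 - d n)" and \<beta>: "\<beta> \<in> forms t" and yf_eq: "y * f = ?G w + L * \<beta>"
    using rep[OF _ xf] rep[OF _ yf] by auto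
  have G_lin: "?G (\<lambda>n. c * v n) = c * ?G v" "?G (\<lambda>n. v n + v' n) = ?G v + ?G v'"
    "?G (\<lambda>n. v n - v' n) = ?G v - ?G v'" for c v v'
    by (simp_all add: sum_distrib_left sum.distrib sum_subtractf algebra_simps)
  \<comment> \<open>Compare the two expressions for \<open>x y f\<close>.\<close>
  have "L * (y * \<alpha> - x * \<beta>) = x * ?G w - y * ?G u"
  proof -
    have "y * (?G u + L * \<alpha>) = x * (?G w + L * \<beta>)"
      unfolding xf_eq[symmetric] yf_eq[symmetric] by (simp add: mult.left_commute)
    then show ?thesis by (simp add: algebra_simps)
  qed
  also have "\<dots> = ?G (\<lambda>n. x * w n - y * u n)" by (simp only: G_lin)
  finally have Leq: "L * (y * \<alpha> - x * \<beta>) = ?G (\<lambda>n. x * w n - y * u n)" .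
  have "L * (y * \<alpha> - x * \<beta>) \<in> I" unfolding Leq by (rule genI)
  then have "y * \<alpha> - x * \<beta> \<in> I" by (rule nzd)
  then obtain h0 where h0: "y * \<alpha> - x * \<beta> = ?G h0" unfolding gen by blast
  have "y * \<alpha> - x * \<beta> \<in> forms (t + 1)"
    using forms_minus[OF forms_mult[OF Var_in_forms \<alpha>] forms_mult[OF Var_in_forms \<beta>]]
    by (simp add: add.commute)
  from form_in_range[OF g this h0] obtain h
    where h: "\<And>n. h n \<in> forms (t + 1 - d n)" and h_eq: "y * \<alpha> - x * \<beta> = ?G h" by blast
  have "?G (\<lambda>n. y * u n - x * w n + L * h n) = 0"
  proof -
    have "?G (\<lambda>n. y * u n - x * w n + L * h n) = y * ?G u - x * ?G w + L * ?G h"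
      by (simp only: G_lin)
    also have "\<dots> = 0" using Leq unfolding h_eq by (simp only: G_lin) simp
    finally show ?thesis .
  qed
  then obtain v0 where v0: "\<And>n. n \<in> {1..r} \<Longrightarrow>
      y * u n - x * w n + L * h n = (\<Sum>l=1..s. v0 l * M l n)"
    unfolding syz by blast
  \<comment> \<open>The coefficients of the syzygy are made homogeneous, of the degree forced by the shifts.\<close>
  define v where "v l = component (t + 2 - a l) (v0 l)" for l
  have v: "y * u n - x * w n + L * h n = (\<Sum>l=1..s. v l * M l n)" if n: "n \<in> {1..r}" for n
  proof -
    have "y * u n \<in> forms (t + 2 - d n)" "x * w n \<in> forms (t + 2 - d n)" "L * h n \<in> forms (t + 2 - d n)"
      using forms_mult[OF Var_in_forms u] forms_mult[OF Var_in_forms w] forms_mult[OF L1 h]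
      by (simp_all add: algebra_simps)
    then have "y * u n - x * w n + L * h n \<in> forms (t + 2 - d n)"
      by (intro forms_add forms_minus)
    then have "y * u n - x * w n + L * h n = component (t + 2 - d n) (\<Sum>l=1..s. v0 l * M l n)"
      unfolding forms_iff_component v0[OF n, symmetric] by simp
    also have "\<dots> = (\<Sum>l=1..s. v l * M l n)"
      unfolding component_sum v_def
    proof (rule sum.cong[OF refl])
      fix l assume "l \<in> {1..s}"
      then have "M l n \<in> forms (a l - d n)" using M n by blast
      then have "component (t + 2 - d n) (v0 l * M l n)
          = component (t + 2 - d n - (a l - d n)) (v0 l) * M l n"
        by (rule component_mult)
      also have "t + 2 - d n - (a l - d n) = t + 2 - a l" by simp
      finally show "component (t + 2 - d n) (v0 l * M l n) = component (t + 2 - a l) (v0 l) * M l n" .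
    qed
    finally show ?thesis .
  qed
  have "\<exists>p q c. v l = p * x + q * y + c * L" if l: "l \<in> {1..s}" for l
  proof (rule positive_form_split)
    show "v l \<in> forms (t + 2 - a l)" by (simp add: v_def)
    have "a l \<le> t + 1" using a l by blast
    then show "t + 2 - a l > 0" by simp
  qed
  then obtain p q c where pqc: "\<And>l. l \<in> {1..s} \<Longrightarrow> v l = p l * x + q l * y + c l * L" by metis
  let ?M = "\<lambda>v n. \<Sum>l=1..s. v l * M l n"
  \<comment> \<open>Opaque names for \<open>p M\<close> and \<open>q M\<close>; they are syzygies, being combinations of rows.\<close>
  define pM qM where "pM n = ?M p n" and "qM n = ?M q n" for n
  have "\<exists>z s s'. u n - qM n = x * z - L * s' \<and> w n + pM n = y * z + L * s" if n: "n \<in> {1..r}" for n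
  proof -
    have "?M v n = (\<Sum>l=1..s. (p l * x + q l * y + c l * L) * M l n)"
      using pqc by (intro sum.cong) auto
    also have "\<dots> = x * ?M p n + y * ?M q n + L * ?M c n"
      by (simp add: sum_distrib_left sum.distrib[symmetric] algebra_simps)
    finally have "y * (u n - qM n) - x * (w n + pM n) + L * (h n - ?M c n) = 0"
      using v[OF n] by (simp add: pM_def qM_def algebra_simps)
    then show ?thesis by (rule Koszul_exact) blast
  qed
  then obtain z \<sigma> \<sigma>' where
    un: "\<And>n. n \<in> {1..r} \<Longrightarrow> u n - qM n = x * z n - L * \<sigma>' n" and
    wn: "\<And>n. n \<in> {1..r} \<Longrightarrow> w n + pM n = y * z n + L * \<sigma> n" by metis
  have "?G (?M v) = 0" for v unfolding syz by blast
  then have GM: "?G pM = 0" "?G qM = 0" unfolding pM_def qM_def by blast+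
  have "?G u = ?G (\<lambda>n. qM n + (x * z n - L * \<sigma>' n))"
    by (intro sum.cong refl) (metis un add.commute diff_add_cancel)
  also have "\<dots> = x * ?G z - L * ?G \<sigma>'" unfolding G_lin GM by simp
  finally have "x * (f - ?G z) = L * (\<alpha> - ?G \<sigma>')" using xf_eq by (simp add: algebra_simps)
  moreover have "?G w = ?G (\<lambda>n. (y * z n + L * \<sigma> n) - pM n)"
    by (intro sum.cong refl) (metis wn add_diff_cancel_right')
  then have "?G w = y * ?G z + L * ?G \<sigma>" unfolding G_lin GM by simp
  then have "y * (f - ?G z) = L * (\<beta> + ?G \<sigma>)" using yf_eq by (simp add: algebra_simps)
  ultimately obtain \<gamma> where "f - ?G z = \<gamma> * L" using L_dvd_if_multiples by blast
  then have "f - \<gamma> * L = ?G z" by (simp add: algebra_simps)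
  then have "f - \<gamma> * L \<in> I" by (simp only: genI)
  then show ?thesis by (rule mem_adjoinI[OF id])
qed

lemma ex_hyperplane_coordinates:
  fixes b :: "3 \<Rightarrow> 'k::field"
  assumes "linear_form b \<noteq> 0"
  obtains i j k where "hyperplane_coordinates i j k b (linear_form b)"
proof -
  obtain i where i: "b i \<noteq> 0" using assms unfolding linear_form_def by (force intro: sum.neutral)
  have "card (UNIV - {i}) = 2" by simp
  then obtain j k where jk: "UNIV - {i} = {j, k}" "j \<noteq> k" unfolding card_2_iff by blast
  have "hyperplane_coordinates i j k b (linear_form b)"
  proof
    show "UNIV = {i, j, k}" "i \<noteq> j" "i \<noteq> k" using jk(1) by auto
  qed (use i jk in auto)
  then show ?thesis by (rule that)
qed

text \<open>
  The algebra \<open>R/(I + (L))\<close> vanishes in large degrees. A form of top degree would be in its socle, so the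
  absence of socle lets the vanishing descend to all \<open>t\<close> with \<open>t \<ge> a\<^sub>l - 1\<close> for every \<open>l\<close>.
\<close>

lemma forms_in_hyperplane_section:
  fixes I :: "(3, 'k::field) mpoly set"
  assumes hom: "homogeneous_ideal I" and sat: "saturated I"
    and res: "minimal_free_resolution I r d s a"
    and L: "\<forall>P\<in>proj_points I. linear_form b \<notin> P" and L0: "linear_form b \<noteq> 0"
    and t: "\<forall>l\<in>{1..s}. a l \<le> t + 1"
  shows "forms t \<subseteq> ideal_gen (I \<union> {linear_form b})"
proof -
  note id = homogeneous_is_ideal[OF hom]
  let ?L = "linear_form b" and ?K = "ideal_gen (I \<union> {linear_form b})"
  obtain i j k where ijk: "hyperplane_coordinates i j k b ?L" using ex_hyperplane_coordinates[OF L0] .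
  obtain g M where g: "\<forall>n\<in>{1..r}. g n \<in> forms (d n)"
    and M: "\<forall>l\<in>{1..s}. \<forall>n\<in>{1..r}. M l n \<in> forms (a l - d n)"
    and gen: "I = range (\<lambda>u. \<Sum>n=1..r. u n * g n)"
    and syz: "\<forall>u. (\<Sum>n=1..r. u n * g n) = 0 \<longleftrightarrow>
             (\<exists>v. \<forall>n\<in>{1..r}. u n = (\<Sum>l=1..s. v l * M l n))"
    using res unfolding minimal_free_resolution_def by (elim exE conjE)
  have nzd: "h \<in> I" if "?L * h \<in> I" for h
    using saturated_nonzerodivisor[OF hom sat linear_form_in_forms L that] .
  have step: "forms t \<subseteq> ?K" if a: "\<forall>l\<in>{1..s}. a l \<le> t + 1" and Suc: "forms (t + 1) \<subseteq> ?K" for t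
  proof
    fix f :: "(3, 'k) mpoly" assume f: "f \<in> forms t"
    have "Var l * f \<in> ?K" for l
      using forms_mult[OF Var_in_forms f, of l] Suc by (auto simp: add.commute)
    then show "f \<in> ?K"
      using hyperplane_coordinates.socle_descent[OF ijk hom nzd g M gen _ a f] syz by blast
  qed
  from contains_high_forms[OF homogeneous_adjoin[OF hom linear_form_in_forms] proj_points_adjoin[OF id L]]
  obtain N where N: "\<And>t. t \<ge> int N \<Longrightarrow> forms t \<subseteq> ?K" by metis
  have "forms t \<subseteq> ?K" if "t \<ge> int N - int m" "\<forall>l\<in>{1..s}. a l \<le> t + 1" for m t
    using that
  proof (induction m arbitrary: t)
    case 0
    then show ?case using N by simp
  next
    case (Suc m)
    have "\<forall>l\<in>{1..s}. a l \<le> t + 1 + 1" using Suc.prems(2) by fastforce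
    then have "forms (t + 1) \<subseteq> ?K" using Suc.prems(1) by (intro Suc.IH) auto
    with Suc.prems(2) show ?case by (rule step)
  qed
  moreover have "t \<ge> int N - int (nat (int N - t))" by linarith
  ultimately show ?thesis using t by blast
qed

section \<open>Maximal rank\<close>

lemma mult_max_rank_injI:
  assumes J: "is_ideal J" and inj: "\<And>f. f \<in> forms i \<Longrightarrow> L * f \<in> J \<Longrightarrow> f \<in> J"
  shows "mult_max_rank J L i"
proof -
  note eq = equiv_ideal_cong[OF J]
  have "inj_on (quotient_mult J L) (quotient_piece J i)"
  proof (rule inj_onI)
    fix C C' assume "C \<in> quotient_piece J i" "C' \<in> quotient_piece J i"
    then obtain f f' where f: "f \<in> forms i" "C = ideal_cong J `` {f}"
      and f': "f' \<in> forms i" "C' = ideal_cong J `` {f'}"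
      unfolding quotient_piece_def by (elim quotientE)
    assume "quotient_mult J L C = quotient_mult J L C'"
    then have "(L * f, L * f') \<in> ideal_cong J"
      by (simp add: f(2) f'(2) quotient_mult_class[OF J] eq_equiv_class_iff[OF eq])
    then have "L * (f - f') \<in> J" by (simp add: ideal_cong_def right_diff_distrib)
    then have "f - f' \<in> J" by (rule inj[OF forms_minus[OF f(1) f'(1)]])
    then have "(f, f') \<in> ideal_cong J" by (simp add: ideal_cong_def)
    then show "C = C'" unfolding f(2) f'(2) by (rule equiv_class_eq[OF eq])
  qed
  then show ?thesis by (simp add: mult_max_rank_def)
qed

lemma mult_max_rank_surjI:
  assumes J: "is_ideal J" and L: "L \<in> forms 1"
    and surj: "\<And>f. f \<in> forms (i + 1) \<Longrightarrow> \<exists>h\<in>forms i. f - h * L \<in> J"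
  shows "mult_max_rank J L i"
proof -
  note eq = equiv_ideal_cong[OF J]
  have "quotient_mult J L ` quotient_piece J i = quotient_piece J (i + 1)"
  proof (intro equalityI subsetI)
    fix C assume "C \<in> quotient_mult J L ` quotient_piece J i"
    then obtain f where "f \<in> forms i" "C = quotient_mult J L (ideal_cong J `` {f})"
      unfolding quotient_piece_def by (elim imageE quotientE) simp
    then show "C \<in> quotient_piece J (i + 1)"
      using forms_mult[OF L, of f i]
      by (auto simp: quotient_mult_class[OF J] quotient_piece_def add.commute intro!: quotientI)
  next
    fix C assume "C \<in> quotient_piece J (i + 1)"
    then obtain f where f: "f \<in> forms (i + 1)" "C = ideal_cong J `` {f}"
      unfolding quotient_piece_def by (elim quotientE)
    obtain h where h: "h \<in> forms i" "f - h * L \<in> J" using surj[OF f(1)] by blast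
    have "(f, L * h) \<in> ideal_cong J" using h(2) by (simp add: ideal_cong_def mult.commute)
    then have "C = quotient_mult J L (ideal_cong J `` {h})"
      unfolding f(2) quotient_mult_class[OF J] by (rule equiv_class_eq[OF eq])
    moreover have "ideal_cong J `` {h} \<in> quotient_piece J i"
      unfolding quotient_piece_def using h(1) by (rule quotientI)
    ultimately show "C \<in> quotient_mult J L ` quotient_piece J i" by blast
  qed
  then show ?thesis by (simp add: mult_max_rank_def)
qed

lemma low_form_mem_adjoin:
  assumes "homogeneous_ideal I" "F \<in> forms e" "p \<in> forms t" "t < e" "p \<in> ideal_gen (I \<union> {F})"
  shows "p \<in> I"
proof -
  obtain h where h: "h \<in> forms (t - e)" "p - h * F \<in> I" using form_mem_adjoin assms(1,2,3,5) .
  have "h = 0" using h(1) assms(4) by (intro forms_negative[of "t - e"]) auto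
  then show ?thesis using h(2) by simp
qed

lemma form_degree_zero:
  assumes "F \<in> forms 0"
  obtains c where "F = Const c"
proof -
  have "m = 0" if "m \<in> Poly_Mapping.keys F" for m
  proof (rule poly_mapping_eqI)
    have "monom_degree m = 0" using that assms by (auto simp: forms_def)
    then show "Poly_Mapping.lookup m i = Poly_Mapping.lookup 0 i" for i
      by (simp add: monom_degree_def)
  qed
  then have "F = Const (Poly_Mapping.lookup F 0)"
    by (intro poly_mapping_eqI) (auto simp: Const_def lookup_single when_def in_keys_iff)
  then show ?thesis by (rule that)
qed

lemma weak_lefschetz_quotient_UNIV: "weak_lefschetz_quotient (UNIV :: ('n::finite, 'k::field) mpoly set)"
proof -
  have "homogeneous_ideal (UNIV :: ('n, 'k) mpoly set)"
    by (simp add: homogeneous_ideal_iff self_module.subspace_UNIV)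
  moreover have "artinian_quotient (UNIV :: ('n, 'k) mpoly set)"
    by (intro artinian_if_contains_high_forms[of _ 0]) (auto simp: self_module.subspace_UNIV)
  moreover have "mult_max_rank (UNIV :: ('n, 'k) mpoly set) L i" for L i
    by (rule mult_max_rank_injI) (auto simp: self_module.subspace_UNIV)
  moreover have "zariski_closed ({} :: ('n \<Rightarrow> 'k) set)"
    unfolding zariski_closed_def by (intro exI[of _ "{1}"]) simp
  then have "for_general_linear_form (\<lambda>_ :: ('n, 'k) mpoly. True)"
    unfolding for_general_linear_form_def by (intro exI[of _ UNIV]) simp
  ultimately show ?thesis by (simp add: weak_lefschetz_quotient_def)
qed

lemma for_general_linear_form_mono:
  assumes "for_general_linear_form Q" "\<And>c. Q (linear_form c) \<Longrightarrow> Q' (linear_form c)"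
  shows "for_general_linear_form Q'"
  using assms unfolding for_general_linear_form_def by blast

theorem proposition6p3:
  fixes I_X :: "(3, 'k::field) mpoly set"
    and F :: "(3, 'k) mpoly"
    and r :: nat
    and d a :: "nat \<Rightarrow> int"
    and e :: int
  assumes "infinite (UNIV :: 'k set)"
    and "zeroscheme_ideal I_X"
    and "minimal_free_resolution I_X r d (r - 1) a"
    and "F \<in> forms e"
    and "\<forall>P\<in>proj_points I_X. F \<notin> P"
    and "e \<ge> Max (a ` {1..r - 1}) - 1"
  shows "weak_lefschetz_quotient (ideal_gen (I_X \<union> {F}))"
proof -
  let ?J = "ideal_gen (I_X \<union> {F})"
  have hom: "homogeneous_ideal I_X" and sat: "saturated I_X" and dim: "proj_dim I_X = 0"
    using assms(2) by (auto simp: zeroscheme_ideal_def)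
  note id = homogeneous_is_ideal[OF hom]
  have PI: "is_ideal P" if "P \<in> proj_points I_X" for P
    using that by (simp add: proj_points_def is_prime_ideal_def)
  obtain P0 where P0: "P0 \<in> proj_points I_X" using proj_points_nonempty[OF dim] by blast
  have "F \<noteq> 0" using P0 assms(5) ideal_zero[OF PI] by blast
  then have "e \<ge> 0" using assms(4) forms_negative by force
  show ?thesis
  \<comment> \<open>For constant \<open>F\<close> the quotient is the zero ring. Otherwise powers of \<open>F\<close> reach all high degrees,
    which bounds the number of points.\<close>
  proof (cases "e = 0")
    case True
    then obtain c where c: "F = Const c" using form_degree_zero assms(4) by metis
    then have "c \<noteq> 0" using \<open>F \<noteq> 0\<close> by auto
    then have "p = (p * Const (inverse c)) * F" for p
      by (simp add: c mult.assoc Const_inverse)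
    then have "?J = UNIV" using self_module.span_scale[OF adjoined_mem] by (metis UNIV_eq_I)
    then show ?thesis using weak_lefschetz_quotient_UNIV by simp
  next
    case False
    then have "e > 0" using \<open>e \<ge> 0\<close> by simp
    have homJ: "homogeneous_ideal ?J" using homogeneous_adjoin[OF hom assms(4)] .
    note idJ = homogeneous_is_ideal[OF homJ]
    obtain N where N: "\<And>t. t \<ge> int N \<Longrightarrow> forms t \<subseteq> ?J"
      using contains_high_forms[OF homJ proj_points_adjoin[OF id assms(5)]] by metis
    have "artinian_quotient ?J" by (rule artinian_if_contains_high_forms[OF idJ N])
    moreover have "for_general_linear_form (\<lambda>L. \<forall>i. mult_max_rank ?J L i)"
    proof (rule for_general_linear_form_mono)
      show "for_general_linear_form (\<lambda>L. \<forall>P\<in>proj_points I_X. L \<notin> P)"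
        using finite_points[OF hom dim assms(4) \<open>e > 0\<close> assms(5)] PI
        by (intro general_linear_form_avoids[OF assms(1)]) (auto simp: proj_points_def)
    next
      fix b :: "3 \<Rightarrow> 'k"
      let ?L = "linear_form b"
      assume L: "\<forall>P\<in>proj_points I_X. ?L \<notin> P"
      then have L0: "?L \<noteq> 0" using P0 ideal_zero[OF PI] by metis
      show "\<forall>i. mult_max_rank ?J ?L i"
      proof
        fix i
        show "mult_max_rank ?J ?L i"
        proof (cases "i + 1 < e")
          case True
          \<comment> \<open>In degrees below \<open>e\<close> the ideal agrees with \<open>I_X\<close>, modulo which \<open>L\<close> is a nonzerodivisor.\<close>
          show ?thesis
          proof (rule mult_max_rank_injI[OF idJ])
            fix f assume f: "f \<in> forms i" "?L * f \<in> ?J"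
            have "?L * f \<in> forms (i + 1)"
              using forms_mult[OF linear_form_in_forms f(1)] by (simp add: add.commute)
            then have "?L * f \<in> I_X" using low_form_mem_adjoin[OF hom assms(4)] True f(2) by blast
            then have "f \<in> I_X" by (rule saturated_nonzerodivisor[OF hom sat linear_form_in_forms L])
            then show "f \<in> ?J" using subset_adjoin by blast
          qed
        next
          case False
          \<comment> \<open>In degrees \<open>i + 1 \<ge> e \<ge> max a - 1\<close> the cokernel of multiplication by \<open>L\<close> is zero already modulo \<open>I_X\<close>.\<close>
          have "a l \<le> (i + 1) + 1" if l: "l \<in> {1..r - 1}" for l
          proof -
            have "a l \<le> Max (a ` {1..r - 1})" using l by simp
            then show ?thesis using assms(6) False by linarith
          qed
          then have *: "forms (i + 1) \<subseteq> ideal_gen (I_X \<union> {?L})"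
            by (intro forms_in_hyperplane_section[OF hom sat assms(3) L L0] ballI)
          show ?thesis
          proof (rule mult_max_rank_surjI[OF idJ linear_form_in_forms])
            fix f :: "(3, 'k) mpoly" assume f: "f \<in> forms (i + 1)"
            then obtain h where "h \<in> forms (i + 1 - 1)" "f - h * ?L \<in> I_X"
              using form_mem_adjoin[OF hom linear_form_in_forms f] * by blast
            then show "\<exists>h\<in>forms i. f - h * ?L \<in> ?J" using subset_adjoin[of I_X F] by auto
          qed
        qed
      qed
    qed
    ultimately show ?thesis using homJ by (simp add: weak_lefschetz_quotient_def)
  qed
qed

end
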